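(* Let $R$ be a ring. Then $R$ is uniquely $\pi$-clean if and only if all of the following hold: (1) $R$ is abelian. (2) Every idempotent lifts modulo $J(R)$. (3) $R/P$ is torsion for every prime (two-sided) ideal $P$ of $R$ with $J(R)\subseteq P$.
   Context: All rings are associative with identity, not necessarily commutative. $\mathbb{N}$ denotes the positive integers, $J(R)$ the Jacobson radical of $R$. A ring is abelian if every idempotent in it is central. Every idempotent lifts modulo $J(R)$ means: for every $a\in R$ with $a-a^2\in J(R)$ there is an idempotent $e\in R$ with $a-e\in J(R)$. A ring $T$ is torsion if for every nonzero $x\in T$ there exists $m\in\mathbb{N}$ with $x^m=1$. An element $x$ of a ring $R$ is uniquely clean if it can be written in exactly one way as $x=e+u$ with $e\in R$ an idempotent and $u\in R$ a unit. A ring $R$ is uniquely $\pi$-clean if for every $a\in R$ there exists $n\in\mathbb{N}$ such that $a^n$ is uniquely clean. *)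

theory Defs
  imports "HOL-Algebra.QuotRing" "HOL-Algebra.Ideal_Product"
begin

text \<open>
  Rings are those of HOL-Algebra: associative with identity, not necessarily commutative,
  the zero ring included.
\<close>

subsection \<open>The Jacobson radical\<close>

locale left_ideal = additive_subgroup I R + ring R for I and R (structure) +
  assumes I_l_closed: "\<lbrakk>a \<in> I; x \<in> carrier R\<rbrakk> \<Longrightarrow> x \<otimes> a \<in> I"

locale maximal_left_ideal = left_ideal +
  assumes I_notcarr: "I \<noteq> carrier R"
    and I_maximal: "\<lbrakk>left_ideal K R; I \<subseteq> K\<rbrakk> \<Longrightarrow> K = I \<or> K = carrier R"

text \<open>
  The intersection of all maximal left ideals, relativised to the carrier, so that the zero ring
  (which has no maximal left ideals) is its own radical.
\<close>

definition jacobson_radical :: "('a, 'b) ring_scheme \<Rightarrow> 'a set"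
  where "jacobson_radical R = {x \<in> carrier R. \<forall>M. maximal_left_ideal M R \<longrightarrow> x \<in> M}"

subsection \<open>Prime two-sided ideals\<close>

text \<open>
  The locale \<open>primeideal\<close> of the library presupposes a commutative ring and expresses complete
  primeness. The usual notion for arbitrary rings is in terms of products of two-sided ideals.
\<close>

locale two_sided_primeideal = ideal P R for P and R (structure) +
  assumes P_notcarr: "P \<noteq> carrier R"
    and P_prime: "\<lbrakk>ideal A R; ideal B R; ideal_prod R A B \<subseteq> P\<rbrakk> \<Longrightarrow> A \<subseteq> P \<or> B \<subseteq> P"

subsection \<open>Idempotents, torsion rings and clean elements\<close>

definition idempotents :: "('a, 'b) ring_scheme \<Rightarrow> 'a set"
  where "idempotents R = {e \<in> carrier R. e \<otimes>\<^bsub>R\<^esub> e = e}"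

definition abelian_ring :: "('a, 'b) ring_scheme \<Rightarrow> bool"
  where "abelian_ring R \<longleftrightarrow>
    (\<forall>e \<in> idempotents R. \<forall>x \<in> carrier R. e \<otimes>\<^bsub>R\<^esub> x = x \<otimes>\<^bsub>R\<^esub> e)"

definition idempotents_lift_mod_radical :: "('a, 'b) ring_scheme \<Rightarrow> bool"
  where "idempotents_lift_mod_radical R \<longleftrightarrow>
    (\<forall>a \<in> carrier R. a \<ominus>\<^bsub>R\<^esub> a [^]\<^bsub>R\<^esub> (2::nat) \<in> jacobson_radical R \<longrightarrow>
      (\<exists>e \<in> idempotents R. a \<ominus>\<^bsub>R\<^esub> e \<in> jacobson_radical R))"

definition torsion_ring :: "('a, 'b) ring_scheme \<Rightarrow> bool"
  where "torsion_ring T \<longleftrightarrow>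
    (\<forall>x \<in> carrier T. x \<noteq> \<zero>\<^bsub>T\<^esub> \<longrightarrow> (\<exists>m::nat. m > 0 \<and> x [^]\<^bsub>T\<^esub> m = \<one>\<^bsub>T\<^esub>))"

definition uniquely_clean :: "('a, 'b) ring_scheme \<Rightarrow> 'a \<Rightarrow> bool"
  where "uniquely_clean R x \<longleftrightarrow>
    (\<exists>!p. p \<in> idempotents R \<times> Units R \<and> x = fst p \<oplus>\<^bsub>R\<^esub> snd p)"

definition uniquely_pi_clean :: "('a, 'b) ring_scheme \<Rightarrow> bool"
  where "uniquely_pi_clean R \<longleftrightarrow>
    (\<forall>a \<in> carrier R. \<exists>n::nat. n > 0 \<and> uniquely_clean R (a [^]\<^bsub>R\<^esub> n))"

end

theory Submission
  imports Defs "HOL-Computational_Algebra.Polynomial"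
begin

text \<open>
  Suppose first that (1)--(3) hold and let \<open>a \<in> R\<close>. An ideal that contains \<open>J = J(R)\<close> and is maximal
  subject to avoiding all \<open>d\<^sub>j = a\<^sup>j (1 - a\<^bsup>j!\<^esup>)\<^sup>j\<close> would be prime, as \<open>d\<^sub>i d\<^sub>j\<close> divides
  \<open>d\<^bsub>i+j\<^esub>\<close>, but in a torsion
  quotient \<open>R/P\<close> either \<open>a\<close> or some \<open>1 - a\<^sup>m\<close> vanishes; hence some \<open>d\<^sub>j\<close> lies in \<open>J\<close>, and
  \<open>b = a\<^bsup>j!\<^esup>\<close> satisfies \<open>b\<^sup>k (1 - b)\<^sup>k \<in> J\<close>. Lifting a suitable polynomial in \<open>b\<close> gives a central
  idempotent \<open>e\<close> such that \<open>1 - b\<close> is nilpotent modulo \<open>J\<close> on \<open>eR\<close> and \<open>b\<close> is so on \<open>(1 - e)R\<close>. Then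
  \<open>b = (1 - e) + (b - (1 - e))\<close> is the only clean decomposition, because an element cannot be both a
  unit and nilpotent modulo \<open>J\<close> on a nonzero corner.

  Conversely, let \<open>R\<close> be uniquely \<open>\<pi>\<close>-clean. Uniqueness for idempotents forces them to be central.
  The clean decomposition of \<open>a\<^sup>n\<close> gives the exchange property, so every element outside \<open>J\<close> has a
  nonzero idempotent left multiple. If \<open>b\<close> is uniquely clean then \<open>b(b - 1) \<in> J\<close>: otherwise \<open>b\<close> and
  \<open>b - 1\<close> are both invertible on some nonzero corner \<open>fR\<close>, and exchanging \<open>0\<close> and \<open>1\<close> there yields a
  second decomposition. Therefore some power of each element is idempotent modulo \<open>J\<close>, and it remains
  to use that \<open>R/J\<close> is reduced.
\<close>

subsection \<open>Left ideals and the Jacobson radical\<close>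

context ring
begin

lemma left_idealI:
  assumes "I \<subseteq> carrier R" "\<zero> \<in> I"
    and add: "\<And>x y. \<lbrakk>x \<in> I; y \<in> I\<rbrakk> \<Longrightarrow> x \<oplus> y \<in> I"
    and mult: "\<And>x r. \<lbrakk>x \<in> I; r \<in> carrier R\<rbrakk> \<Longrightarrow> r \<otimes> x \<in> I"
  shows "left_ideal I R"
proof -
  have "\<ominus> x \<in> I" if "x \<in> I" for x
    using mult[OF that, of "\<ominus> \<one>"] that assms(1) l_minus[of \<one> x] by auto
  then have "subgroup I (add_monoid R)"
    using assms by (auto simp: subgroup_def a_inv_def)
  then show ?thesis
    using mult by (simp add: left_ideal.intro left_ideal_axioms.intro additive_subgroupI ring_axioms)
qed

lemma left_ideal_closed:
  assumes "left_ideal I R"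
  shows "I \<subseteq> carrier R" "\<zero> \<in> I"
    and "\<lbrakk>x \<in> I; y \<in> I\<rbrakk> \<Longrightarrow> x \<oplus> y \<in> I"
    and "\<lbrakk>x \<in> I; r \<in> carrier R\<rbrakk> \<Longrightarrow> r \<otimes> x \<in> I"
proof -
  interpret left_ideal I R by fact
  show "I \<subseteq> carrier R" "\<zero> \<in> I" "\<lbrakk>x \<in> I; y \<in> I\<rbrakk> \<Longrightarrow> x \<oplus> y \<in> I"
    "\<lbrakk>x \<in> I; r \<in> carrier R\<rbrakk> \<Longrightarrow> r \<otimes> x \<in> I"
    by (auto intro: a_subset[THEN subsetD] I_l_closed)
qed

lemma ideal_closed:
  assumes "ideal I R"
  shows "I \<subseteq> carrier R" "\<zero> \<in> I"
    and "\<lbrakk>x \<in> I; y \<in> I\<rbrakk> \<Longrightarrow> x \<oplus> y \<in> I" "\<lbrakk>x \<in> I; y \<in> I\<rbrakk> \<Longrightarrow> x \<ominus> y \<in> I"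
    and "\<lbrakk>x \<in> I; r \<in> carrier R\<rbrakk> \<Longrightarrow> r \<otimes> x \<in> I" "\<lbrakk>x \<in> I; r \<in> carrier R\<rbrakk> \<Longrightarrow> x \<otimes> r \<in> I"
proof -
  interpret ideal I R by fact
  show "I \<subseteq> carrier R" "\<zero> \<in> I" "\<lbrakk>x \<in> I; y \<in> I\<rbrakk> \<Longrightarrow> x \<oplus> y \<in> I" "\<lbrakk>x \<in> I; y \<in> I\<rbrakk> \<Longrightarrow> x \<ominus> y \<in> I"
    "\<lbrakk>x \<in> I; r \<in> carrier R\<rbrakk> \<Longrightarrow> r \<otimes> x \<in> I" "\<lbrakk>x \<in> I; r \<in> carrier R\<rbrakk> \<Longrightarrow> x \<otimes> r \<in> I"
    by (auto simp: minus_eq intro: a_subset[THEN subsetD] I_l_closed I_r_closed)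
qed

lemma ideal_of_left_ideal:
  assumes "left_ideal I R" "\<And>x r. \<lbrakk>x \<in> I; r \<in> carrier R\<rbrakk> \<Longrightarrow> x \<otimes> r \<in> I"
  shows "ideal I R"
proof -
  interpret left_ideal I R by fact
  show ?thesis
    by unfold_locales (auto intro: I_l_closed assms(2))
qed

lemma ideal_imp_left_ideal: "ideal I R \<Longrightarrow> left_ideal I R"
  by (rule left_idealI) (auto dest: ideal_closed)

lemma left_ideal_eq_carrier: "left_ideal I R \<Longrightarrow> \<one> \<in> I \<Longrightarrow> I = carrier R"
  using left_ideal_closed[of I] by (metis r_one subsetI subset_antisym)

text \<open>This is the left ideal \<open>Ra + L\<close>. With \<open>L\<close> maximal it yields
  comaximality, with \<open>L = {\<zero>}\<close> a principal left ideal.\<close>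

lemma left_ideal_insert:
  assumes "left_ideal L R" "a \<in> carrier R"
  shows "left_ideal {r \<otimes> a \<oplus> l | r l. r \<in> carrier R \<and> l \<in> L} R" (is "left_ideal ?K R")
proof (rule left_idealI)
  note L = left_ideal_closed[OF assms(1)]
  show "?K \<subseteq> carrier R" using L(1) assms(2) by auto
  have "\<zero> = \<zero> \<otimes> a \<oplus> \<zero>" using assms(2) by simp
  then show "\<zero> \<in> ?K" using L(2) by blast
  show "x \<oplus> y \<in> ?K" if "x \<in> ?K" "y \<in> ?K" for x y
  proof -
    from that obtain r l r' l' where *: "x = r \<otimes> a \<oplus> l" "y = r' \<otimes> a \<oplus> l'"
      "r \<in> carrier R" "r' \<in> carrier R" "l \<in> L" "l' \<in> L" by auto
    then have "l \<in> carrier R" "l' \<in> carrier R" using L(1) by auto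
    then have "x \<oplus> y = (r \<oplus> r') \<otimes> a \<oplus> (l \<oplus> l')"
      unfolding * using * assms(2) by algebra
    then show ?thesis using * L(3) by blast
  qed
  show "s \<otimes> x \<in> ?K" if "x \<in> ?K" "s \<in> carrier R" for x s
  proof -
    from that obtain r l where *: "x = r \<otimes> a \<oplus> l" "r \<in> carrier R" "l \<in> L" by auto
    then have "l \<in> carrier R" using L(1) by auto
    then have "s \<otimes> x = (s \<otimes> r) \<otimes> a \<oplus> s \<otimes> l"
      unfolding * using * assms(2) that by algebra
    then show ?thesis using * L(4) that by blast
  qed
qed

lemma left_ideal_chain_Union:
  assumes "\<C> \<noteq> {}" "subset.chain {I. left_ideal I R} \<C>"
  shows "left_ideal (\<Union>\<C>) R"
proof (rule left_idealI)
  have C: "left_ideal I R" if "I \<in> \<C>" for I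
    using assms that by (auto simp: subset_chain_def)
  note D = left_ideal_closed[OF C]
  show "\<Union>\<C> \<subseteq> carrier R" using D(1) by auto
  show "\<zero> \<in> \<Union>\<C>" using D(2) assms(1) by auto
  show "x \<oplus> y \<in> \<Union>\<C>" if "x \<in> \<Union>\<C>" "y \<in> \<Union>\<C>" for x y
  proof -
    from that obtain I I' where "x \<in> I" "y \<in> I'" "I \<in> \<C>" "I' \<in> \<C>" by auto
    moreover then have "I \<subseteq> I' \<or> I' \<subseteq> I" using assms(2) by (auto simp: subset_chain_def)
    ultimately show ?thesis using D(3) by blast
  qed
  show "r \<otimes> x \<in> \<Union>\<C>" if "x \<in> \<Union>\<C>" "r \<in> carrier R" for x r
    using that D(4) by auto
qed

lemma ideal_chain_Union:
  assumes "\<C> \<noteq> {}" "subset.chain {I. ideal I R} \<C>"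
  shows "ideal (\<Union>\<C>) R"
proof (rule ideal_of_left_ideal)
  have C: "ideal I R" if "I \<in> \<C>" for I
    using assms that by (auto simp: subset_chain_def)
  show "left_ideal (\<Union>\<C>) R"
    using assms ideal_imp_left_ideal by (intro left_ideal_chain_Union) (auto simp: subset_chain_def)
  show "x \<otimes> r \<in> \<Union>\<C>" if "x \<in> \<Union>\<C>" "r \<in> carrier R" for x r
    using that ideal_closed(6)[OF C] by auto
qed

text \<open>Zorn's lemma applies because properness of a left ideal means avoiding
  \<open>\<one>\<close>, a condition that survives unions of chains.\<close>

lemma maximal_left_ideal_exists:
  assumes I: "left_ideal I R" "\<one> \<notin> I"
  shows "\<exists>M. maximal_left_ideal M R \<and> I \<subseteq> M"
proof -
  let ?A = "{K. left_ideal K R \<and> \<one> \<notin> K \<and> I \<subseteq> K}"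
  have "\<exists>M\<in>?A. \<forall>X\<in>?A. M \<subseteq> X \<longrightarrow> X = M"
  proof (rule subset_Zorn_nonempty)
    show "?A \<noteq> {}" using I by auto
    show "\<Union>\<C> \<in> ?A" if "\<C> \<noteq> {}" "subset.chain ?A \<C>" for \<C>
    proof -
      have "left_ideal (\<Union>\<C>) R"
        using that by (intro left_ideal_chain_Union) (auto simp: subset_chain_def)
      then show ?thesis using that unfolding subset_chain_def by blast
    qed
  qed
  then obtain M where M: "M \<in> ?A" "\<forall>X\<in>?A. M \<subseteq> X \<longrightarrow> X = M" by (rule bexE)
  interpret left_ideal M R using M(1) by simp
  have "maximal_left_ideal M R"
  proof unfold_locales
    show "M \<noteq> carrier R" using M(1) by auto
    show "K = M \<or> K = carrier R" if "left_ideal K R" "M \<subseteq> K" for K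
      using that M left_ideal_eq_carrier[of K] by blast
  qed
  then show ?thesis using M(1) by auto
qed

lemma maximal_left_ideal_comaximal:
  assumes M: "maximal_left_ideal M R" and a: "a \<in> carrier R" "a \<notin> M"
  shows "\<exists>r\<in>carrier R. \<exists>l\<in>M. r \<otimes> a \<oplus> l = \<one>"
proof -
  have L: "left_ideal M R" using M by (rule maximal_left_ideal.axioms)
  note Lc = left_ideal_closed[OF L]
  let ?K = "{r \<otimes> a \<oplus> l | r l. r \<in> carrier R \<and> l \<in> M}"
  have "M \<subseteq> ?K"
  proof
    fix x assume x: "x \<in> M"
    then have "x = \<zero> \<otimes> a \<oplus> x" using Lc(1) a by auto
    then show "x \<in> ?K" using x by blast
  qed
  moreover have "a \<in> ?K"
  proof -
    have "a = \<one> \<otimes> a \<oplus> \<zero>" using a by simp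
    then show ?thesis using Lc(2) by blast
  qed
  ultimately have "?K = carrier R"
    using maximal_left_ideal.I_maximal[OF M left_ideal_insert[OF L a(1)]] a(2) by blast
  then have "\<one> \<in> ?K" by simp
  then show ?thesis by force
qed

lemma maximal_left_ideal_one: "maximal_left_ideal M R \<Longrightarrow> \<one> \<notin> M"
  using left_ideal_eq_carrier[of M] by (auto simp: maximal_left_ideal_def maximal_left_ideal_axioms_def)

section \<open>The Jacobson radical as a two-sided ideal, and its relation to units\<close>

lemma left_ideal_jacobson_radical: "left_ideal (jacobson_radical R) R"
proof (rule left_idealI)
  have *: "left_ideal M R" if "maximal_left_ideal M R" for M
    using that by (rule maximal_left_ideal.axioms)
  note D = left_ideal_closed[OF *]
  show "jacobson_radical R \<subseteq> carrier R" "\<zero> \<in> jacobson_radical R"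
    "\<lbrakk>x \<in> jacobson_radical R; y \<in> jacobson_radical R\<rbrakk> \<Longrightarrow> x \<oplus> y \<in> jacobson_radical R"
    "\<lbrakk>x \<in> jacobson_radical R; r \<in> carrier R\<rbrakk> \<Longrightarrow> r \<otimes> x \<in> jacobson_radical R" for x y r
    using D(2-) by (auto simp: jacobson_radical_def)
qed

text \<open>If \<open>1 - rx\<close> had no left inverse, the proper left ideal
  \<open>R(1 - rx)\<close> would lie in some maximal \<open>M\<close>; since \<open>rx\<close> is in
  \<open>M\<close> too, so would be \<open>1\<close>. Conversely, \<open>x\<close> outside
  \<open>M\<close> gives \<open>1 = rx + l\<close> with \<open>l\<close> in \<open>M\<close>, and a
  left inverse of \<open>l = 1 - rx\<close> again puts \<open>1\<close> into
  \<open>M\<close>.\<close>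

lemma jacobson_radical_iff:
  "x \<in> jacobson_radical R \<longleftrightarrow>
    x \<in> carrier R \<and> (\<forall>r\<in>carrier R. \<exists>c\<in>carrier R. c \<otimes> (\<one> \<ominus> r \<otimes> x) = \<one>)"
    (is "_ \<longleftrightarrow> _ \<and> ?inv")
proof safe
  note J = left_ideal_closed[OF left_ideal_jacobson_radical]
  assume x: "x \<in> jacobson_radical R"
  then show xc: "x \<in> carrier R" using J(1) by auto
  fix r assume r: "r \<in> carrier R"
  let ?K = "{c \<otimes> (\<one> \<ominus> r \<otimes> x) \<oplus> l | c l. c \<in> carrier R \<and> l \<in> {\<zero>}}"
  have K: "left_ideal ?K R"
    using r xc by (intro left_ideal_insert ideal_imp_left_ideal zeroideal) auto
  have mem: "\<one> \<ominus> r \<otimes> x \<in> ?K"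
  proof -
    have "\<one> \<ominus> r \<otimes> x = \<one> \<otimes> (\<one> \<ominus> r \<otimes> x) \<oplus> \<zero>" using r xc by simp
    then show ?thesis by blast
  qed
  have "\<one> \<in> ?K"
  proof (rule ccontr)
    assume "\<one> \<notin> ?K"
    then obtain M where M: "maximal_left_ideal M R" "?K \<subseteq> M"
      using maximal_left_ideal_exists[OF K] by blast
    have "r \<otimes> x \<in> M"
      using J(4)[OF x r] M by (auto simp: jacobson_radical_def)
    moreover have "\<one> \<ominus> r \<otimes> x \<in> M" using mem M(2) by blast
    ultimately have "(\<one> \<ominus> r \<otimes> x) \<oplus> r \<otimes> x \<in> M"
      using left_ideal_closed(3)[OF maximal_left_ideal.axioms(1)[OF M(1)]] by blast
    moreover have "(\<one> \<ominus> r \<otimes> x) \<oplus> r \<otimes> x = \<one>" using r xc by algebra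
    ultimately show False using maximal_left_ideal_one[OF M(1)] by simp
  qed
  then show "\<exists>c\<in>carrier R. c \<otimes> (\<one> \<ominus> r \<otimes> x) = \<one>" using r xc by force
next
  assume x: "x \<in> carrier R" and inv: ?inv
  have "x \<in> M" if M: "maximal_left_ideal M R" for M
  proof (rule ccontr)
    assume "x \<notin> M"
    then obtain r l where rl: "r \<in> carrier R" "l \<in> M" "r \<otimes> x \<oplus> l = \<one>"
      using maximal_left_ideal_comaximal[OF M x] by blast
    note Mc = left_ideal_closed[OF maximal_left_ideal.axioms(1)[OF M]]
    obtain c where c: "c \<in> carrier R" "c \<otimes> (\<one> \<ominus> r \<otimes> x) = \<one>" using inv rl by blast
    have "l \<in> carrier R" using Mc(1) rl by auto
    then have "\<one> \<ominus> r \<otimes> x = l" unfolding rl(3)[symmetric] using rl(1) x by algebra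
    then have "\<one> \<in> M" using Mc(4)[OF rl(2) c(1)] c(2) by simp
    then show False using maximal_left_ideal_one[OF M] by simp
  qed
  then show "x \<in> jacobson_radical R" using x by (simp add: jacobson_radical_def)
qed

text \<open>Maximal left ideals say nothing about right multiples. The criterion by left inverses
  does, because left invertibility of \<open>1 - yx\<close> passes to \<open>1 - xy\<close>.\<close>

lemma ideal_jacobson_radical: "ideal (jacobson_radical R) R"
proof (rule ideal_of_left_ideal[OF left_ideal_jacobson_radical])
  fix x s assume x: "x \<in> jacobson_radical R" and s: "s \<in> carrier R"
  then have xc: "x \<in> carrier R" by (simp add: jacobson_radical_def)
  have "\<exists>d\<in>carrier R. d \<otimes> (\<one> \<ominus> r \<otimes> (x \<otimes> s)) = \<one>" if r: "r \<in> carrier R" for r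
  proof -
    obtain c where c: "c \<in> carrier R" "c \<otimes> (\<one> \<ominus> s \<otimes> r \<otimes> x) = \<one>"
      using x s r unfolding jacobson_radical_iff[of x] by blast
    \<comment> \<open>if \<open>c\<close> is a left inverse of \<open>1 - yx\<close> then \<open>1 + xcy\<close> is a left inverse of \<open>1 - xy\<close>\<close>
    have "(\<one> \<oplus> r \<otimes> x \<otimes> c \<otimes> s) \<otimes> (\<one> \<ominus> r \<otimes> (x \<otimes> s))
        = \<one> \<ominus> r \<otimes> x \<otimes> s \<oplus> r \<otimes> x \<otimes> (c \<otimes> (\<one> \<ominus> s \<otimes> r \<otimes> x)) \<otimes> s"
      using xc s r c(1) by (simp add: ring_simprules)
    also have "\<dots> = \<one>" unfolding c(2) using xc s r by algebra
    finally show ?thesis using xc s r c(1) by (intro bexI[of _ "\<one> \<oplus> r \<otimes> x \<otimes> c \<otimes> s"]) auto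
  qed
  then show "x \<otimes> s \<in> jacobson_radical R"
    unfolding jacobson_radical_iff[of "x \<otimes> s"] using xc s by blast
qed

lemmas jr_closed = ideal_closed[OF ideal_jacobson_radical]

text \<open>A left inverse \<open>c\<close> of \<open>1 - x\<close> equals \<open>1 + cx\<close>,
  which has the same shape and therefore has a left inverse \<open>d\<close> itself. Then
  \<open>c\<close> is invertible on both sides and \<open>1 - x = d\<close>.\<close>

lemma one_minus_jacobson_radical_Unit:
  assumes x: "x \<in> jacobson_radical R"
  shows "\<one> \<ominus> x \<in> Units R"
proof -
  have xc: "x \<in> carrier R" using x jr_closed by auto
  obtain c where c: "c \<in> carrier R" "c \<otimes> (\<one> \<ominus> x) = \<one>"
    using x xc unfolding jacobson_radical_iff[of x] by (auto dest!: bspec[of _ _ \<one>])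
  obtain d where d: "d \<in> carrier R" "d \<otimes> (\<one> \<ominus> (\<ominus> c) \<otimes> x) = \<one>"
    using x c unfolding jacobson_radical_iff[of x] by blast
  have "\<one> \<ominus> (\<ominus> c) \<otimes> x = c \<otimes> (\<one> \<ominus> x) \<oplus> c \<otimes> x" unfolding c(2) using c(1) xc by algebra
  also have "\<dots> = c" using c(1) xc by (simp add: ring_simprules)
  finally have dc: "d \<otimes> c = \<one>" using d by simp
  have "\<one> \<ominus> x = d \<otimes> c \<otimes> (\<one> \<ominus> x)" unfolding dc using xc by simp
  also have "\<dots> = d" using c d(1) xc by (simp add: m_assoc)
  finally show ?thesis using c dc xc unfolding Units_def by auto
qed

lemma idempotent_jacobson_radical:
  assumes e: "e \<in> idempotents R" "e \<in> jacobson_radical R"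
  shows "e = \<zero>"
proof -
  have ec: "e \<in> carrier R" "e \<otimes> e = e" using e by (auto simp: idempotents_def)
  have u: "\<one> \<ominus> e \<in> Units R" using e by (intro one_minus_jacobson_radical_Unit)
  have "e = e \<otimes> ((\<one> \<ominus> e) \<otimes> inv (\<one> \<ominus> e))" using u ec by simp
  also have "\<dots> = (e \<ominus> e \<otimes> e) \<otimes> inv (\<one> \<ominus> e)"
    using Units_inv_closed[OF u] ec(1) by algebra
  also have "\<dots> = \<zero>" unfolding ec(2) using Units_inv_closed[OF u] ec(1) by algebra
  finally show ?thesis .
qed

end

subsection \<open>Evaluation of integer polynomials\<close>

text \<open>
  The powers of one element generate a commutative subring, so identities and divisibilities among
  polynomial expressions in it may be checked in \<^typ>\<open>int poly\<close>.
\<close>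

definition (in ring) int_poly_eval :: "'a \<Rightarrow> int poly \<Rightarrow> 'a"
  where "int_poly_eval a p = fold_coeffs (\<lambda>c x. add_pow R c \<one> \<oplus> a \<otimes> x) p \<zero>"

context ring
begin

lemma add_pow_int_zero: "add_pow R (0 :: int) x = \<zero>"
  by (simp add: add_pow_def)

context
  fixes a
  assumes a: "a \<in> carrier R"
begin

lemma int_poly_eval_0 [simp]: "int_poly_eval a 0 = \<zero>"
  by (simp add: int_poly_eval_def)

lemma int_poly_eval_pCons: "int_poly_eval a (pCons c p) = add_pow R c \<one> \<oplus> a \<otimes> int_poly_eval a p"
  \<comment> \<open>\<open>fold_coeffs\<close> performs no step on \<open>pCons 0 0\<close>, so this
    case is separate; both sides are then zero.\<close>
  using a by (cases "c = 0 \<and> p = 0") (auto simp: int_poly_eval_def add_pow_def int_pow_def)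

lemma int_poly_eval_closed [simp]: "int_poly_eval a p \<in> carrier R"
  by (induction p) (use a in \<open>auto simp: int_poly_eval_pCons\<close>)

lemma int_poly_eval_add: "int_poly_eval a (p + q) = int_poly_eval a p \<oplus> int_poly_eval a q"
proof (induction p q rule: poly_induct2)
  case (pCons c p d q)
  have "add_pow R (c + d) \<one> = add_pow R c \<one> \<oplus> add_pow R d \<one>"
    by (simp add: add.int_pow_mult)
  then show ?case
    using a by (simp add: int_poly_eval_pCons pCons.IH r_distr a_ac)
qed simp

lemma int_poly_eval_smult: "int_poly_eval a (smult c p) = add_pow R c (int_poly_eval a p)"
proof (induction p)
  case (pCons d p)
  have "add_pow R (c * d) \<one> = add_pow R c (add_pow R d \<one>)"
    by (simp add: add.int_pow_pow mult.commute)
  then show ?case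
    using a by (simp add: int_poly_eval_pCons pCons.IH add.int_pow_distrib add_pow_rdistr_int)
qed (simp add: add.int_pow_one)

lemma int_poly_eval_mult: "int_poly_eval a (p * q) = int_poly_eval a p \<otimes> int_poly_eval a q"
proof (induction p)
  case (pCons c p)
  have "int_poly_eval a (smult c q) = (add_pow R c \<one>) \<otimes> int_poly_eval a q"
    by (simp add: int_poly_eval_smult add_pow_ldistr_int)
  then show ?case
    using a by (simp add: int_poly_eval_add int_poly_eval_pCons pCons.IH l_distr m_assoc add_pow_int_zero)
qed simp

lemma int_poly_eval_1 [simp]: "int_poly_eval a 1 = \<one>"
  using a by (simp add: one_pCons int_poly_eval_pCons add_pow_int_zero)

lemma int_poly_eval_X [simp]: "int_poly_eval a [:0, 1:] = a"
  using a by (simp add: int_poly_eval_pCons add_pow_int_zero)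

lemma int_poly_eval_diff: "int_poly_eval a (p - q) = int_poly_eval a p \<ominus> int_poly_eval a q"
proof -
  have "int_poly_eval a p = int_poly_eval a (p - q) \<oplus> int_poly_eval a q"
    by (simp flip: int_poly_eval_add)
  then show ?thesis by (simp add: minus_eq a_assoc r_neg)
qed

lemma int_poly_eval_power: "int_poly_eval a (p ^ n) = int_poly_eval a p [^] n"
proof (induction n)
  case (Suc n)
  then show ?case by (simp add: int_poly_eval_mult del: nat_pow_Suc flip: nat_pow_Suc2)
qed simp

lemmas int_poly_eval_simps =
  int_poly_eval_add int_poly_eval_diff int_poly_eval_mult int_poly_eval_power

text \<open>Reduces membership of polynomial expressions in an ideal to divisibility of integer
  polynomials.\<close>

lemma int_poly_eval_dvd:
  assumes "ideal I R" "int_poly_eval a p \<in> I" "p dvd q"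
  shows "int_poly_eval a q \<in> I"
  using assms ideal_closed(6)[OF assms(1,2)] by (auto simp: int_poly_eval_mult)

end

text \<open>\<open>x\<close> has the right inverse \<open>y (xy)^-1\<close> and the left inverse
  \<open>(yx)^-1 y\<close>, and these must agree.\<close>

lemma Units_of_products:
  assumes "x \<in> carrier R" "y \<in> carrier R" "x \<otimes> y \<in> Units R" "y \<otimes> x \<in> Units R"
  shows "x \<in> Units R"
proof -
  define r l where "r = y \<otimes> inv (x \<otimes> y)" and "l = inv (y \<otimes> x) \<otimes> y"
  have c: "r \<in> carrier R" "l \<in> carrier R" using assms by (auto simp: r_def l_def)
  have r: "x \<otimes> r = \<one>"
    using assms by (simp add: r_def flip: m_assoc)
  have l: "l \<otimes> x = \<one>"
    using assms Units_l_inv[OF assms(4)] by (simp add: l_def m_assoc)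
  have "l = r" using inv_unique[OF l r] assms(1) c by simp
  then show ?thesis using r l c assms(1) unfolding Units_def by blast
qed

text \<open>The geometric sum \<open>q\<close> satisfies
  \<open>(1 - y) q = q (1 - y) = 1 - y^k\<close>, which is a unit because \<open>y^k\<close> lies in
  the radical.\<close>

lemma one_minus_Unit_of_power_mem:
  assumes y: "y \<in> carrier R" "y [^] (k::nat) \<in> jacobson_radical R"
  shows "\<one> \<ominus> y \<in> Units R"
proof -
  define X :: "int poly" where "X = [:0, 1:]"
  define q where "q = (\<Sum>i<k. X ^ i)"
  have X: "int_poly_eval y X = y" using y(1) by (simp add: X_def)
  have q: "(1 - X) * q = 1 - X ^ k"
    unfolding q_def by (rule one_diff_power_eq[symmetric])
  then have q': "q * (1 - X) = 1 - X ^ k" by (simp only: mult.commute)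
  have "(\<one> \<ominus> y) \<otimes> int_poly_eval y q = \<one> \<ominus> y [^] k"
    using arg_cong[OF q, of "int_poly_eval y"] y(1) by (simp add: int_poly_eval_simps X)
  moreover have "int_poly_eval y q \<otimes> (\<one> \<ominus> y) = \<one> \<ominus> y [^] k"
    using arg_cong[OF q', of "int_poly_eval y"] y(1) by (simp add: int_poly_eval_simps X)
  ultimately show ?thesis
    using one_minus_jacobson_radical_Unit[OF y(2)] y(1) Units_of_products[of "\<one> \<ominus> y" "int_poly_eval y q"]
    by simp
qed

end

subsection \<open>Prime ideals and torsion quotients\<close>

context ring
begin

lemma torsion_Quot_iff:
  assumes "ideal P R"
  shows "torsion_ring (R Quot P) \<longleftrightarrow>
    (\<forall>a\<in>carrier R. a \<notin> P \<longrightarrow> (\<exists>m::nat. m > 0 \<and> a [^] m \<ominus> \<one> \<in> P))"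
proof -
  have carr: "carrier (R Quot P) = (+>) P ` carrier R"
    by (auto simp: FactRing_def A_RCOSETS_def')
  have zero: "P +> a = \<zero>\<^bsub>R Quot P\<^esub> \<longleftrightarrow> a \<in> P" if "a \<in> carrier R" for a
  proof
    show "P +> a = \<zero>\<^bsub>R Quot P\<^esub>" if "a \<in> P"
      using a_rcos_zero[OF assms that] by (simp add: FactRing_def)
    show "a \<in> P" if "P +> a = \<zero>\<^bsub>R Quot P\<^esub>"
      using ideal.rcos_const_imp_mem[OF assms \<open>a \<in> carrier R\<close>] that by (simp add: FactRing_def)
  qed
  have pow: "(P +> a) [^]\<^bsub>R Quot P\<^esub> m = \<one>\<^bsub>R Quot P\<^esub> \<longleftrightarrow> a [^] m \<ominus> \<one> \<in> P"
    if a: "a \<in> carrier R" for a and m :: nat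
  proof -
    have "(P +> a) [^]\<^bsub>R Quot P\<^esub> m = P +> a [^] m"
      by (rule ring_hom_ring.hom_nat_pow[OF ideal.rcos_ring_hom_ring[OF assms] a, symmetric])
    moreover have "\<one>\<^bsub>R Quot P\<^esub> = P +> \<one>" by (simp add: FactRing_def)
    ultimately show ?thesis
      using quotient_eq_iff_same_a_r_cos[OF assms nat_pow_closed[OF a, of m] one_closed] by simp
  qed
  have "torsion_ring (R Quot P) \<longleftrightarrow> (\<forall>a\<in>carrier R. P +> a \<noteq> \<zero>\<^bsub>R Quot P\<^esub> \<longrightarrow>
      (\<exists>m::nat. m > 0 \<and> (P +> a) [^]\<^bsub>R Quot P\<^esub> m = \<one>\<^bsub>R Quot P\<^esub>))"
    unfolding torsion_ring_def carr by (rule ball_simps(9))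
  also have "\<dots> \<longleftrightarrow> (\<forall>a\<in>carrier R. a \<notin> P \<longrightarrow> (\<exists>m::nat. m > 0 \<and> a [^] m \<ominus> \<one> \<in> P))"
    by (rule ball_cong[OF refl]) (simp only: zero pow)
  finally show ?thesis .
qed

text \<open>An ideal \<open>P\<close> maximal among those containing \<open>I\<close> and avoiding
  \<open>S\<close> is prime. If neither \<open>A\<close> nor \<open>B\<close> lies in
  \<open>P\<close>, then \<open>P + A\<close> and \<open>P + B\<close> meet \<open>S\<close> in some
  \<open>s = p + x\<close> and \<open>t = q + y\<close>. An element \<open>s r t\<close> of
  \<open>S\<close> is congruent to \<open>x r y\<close> modulo \<open>P\<close>, so
  \<open>AB\<close> inside \<open>P\<close> would force it into \<open>P\<close>.\<close>

lemma m_system_prime_exists: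
  assumes I: "ideal I R" and S: "S \<subseteq> carrier R" "S \<noteq> {}" "S \<inter> I = {}"
    and m: "\<And>s t. \<lbrakk>s \<in> S; t \<in> S\<rbrakk> \<Longrightarrow> \<exists>r\<in>carrier R. s \<otimes> r \<otimes> t \<in> S"
  shows "\<exists>P. two_sided_primeideal P R \<and> I \<subseteq> P \<and> S \<inter> P = {}"
proof -
  let ?A = "{K. ideal K R \<and> S \<inter> K = {} \<and> I \<subseteq> K}"
  have "\<exists>M\<in>?A. \<forall>X\<in>?A. M \<subseteq> X \<longrightarrow> X = M"
  proof (rule subset_Zorn_nonempty)
    show "?A \<noteq> {}" using I S by auto
    show "\<Union>\<C> \<in> ?A" if "\<C> \<noteq> {}" "subset.chain ?A \<C>" for \<C>
    proof -
      have "ideal (\<Union>\<C>) R"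
        using that by (intro ideal_chain_Union) (auto simp: subset_chain_def)
      then show ?thesis using that unfolding subset_chain_def by blast
    qed
  qed
  then obtain P where P: "P \<in> ?A" and max: "\<forall>X\<in>?A. P \<subseteq> X \<longrightarrow> X = P" by (rule bexE)
  then interpret ideal P R by simp
  have P_ideal: "ideal P R" by (rule is_ideal)
  note Pc = ideal_closed[OF P_ideal]
  have meets: "\<exists>s\<in>S. \<exists>p\<in>P. \<exists>x\<in>K. s = p \<oplus> x" if K: "ideal K R" "\<not> K \<subseteq> P" for K
  proof -
    note Kc = ideal_closed[OF K(1)]
    have PK: "ideal (P <+> K) R" by (rule add_ideals[OF P_ideal K(1)])
    have mem: "p \<oplus> x \<in> P <+> K" if "p \<in> P" "x \<in> K" for p x
      using that by (auto simp: set_add_def')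
    have sub: "P \<subseteq> P <+> K"
    proof
      fix p assume "p \<in> P"
      then show "p \<in> P <+> K" using mem[of p \<zero>] Kc(2) Pc(1) by auto
    qed
    obtain x where x: "x \<in> K" "x \<notin> P" using K(2) by blast
    then have "x \<in> P <+> K" using mem[of \<zero> x] Kc(1) Pc(2) by auto
    then have ne: "P <+> K \<noteq> P" using x(2) by blast
    have "S \<inter> (P <+> K) \<noteq> {}"
    proof
      assume "S \<inter> (P <+> K) = {}"
      then have "P <+> K \<in> ?A" using PK sub P by auto
      then show False using max sub ne by blast
    qed
    then show ?thesis by (auto simp: set_add_def')
  qed
  have "two_sided_primeideal P R"
  proof unfold_locales
    show "P \<noteq> carrier R" using P S by auto
    fix A B assume A: "ideal A R" and B: "ideal B R" and AB: "ideal_prod R A B \<subseteq> P"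
    note Ac = ideal_closed[OF A] and Bc = ideal_closed[OF B]
    show "A \<subseteq> P \<or> B \<subseteq> P"
    proof (rule ccontr)
      assume "\<not> (A \<subseteq> P \<or> B \<subseteq> P)"
      then obtain s p x t q y where
        s: "s \<in> S" "p \<in> P" "x \<in> A" "s = p \<oplus> x" and t: "t \<in> S" "q \<in> P" "y \<in> B" "t = q \<oplus> y"
        using meets[OF A] meets[OF B] by meson
      obtain r where r: "r \<in> carrier R" "s \<otimes> r \<otimes> t \<in> S" using m[OF s(1) t(1)] by blast
      have c: "p \<in> carrier R" "x \<in> carrier R" "q \<in> carrier R" "y \<in> carrier R" "t \<in> carrier R"
        using s t Pc(1) Ac(1) Bc(1) S by auto
      have "s \<otimes> r \<otimes> t = (p \<otimes> (r \<otimes> t) \<oplus> (x \<otimes> r) \<otimes> q) \<oplus> (x \<otimes> r) \<otimes> y"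
        unfolding s(4) t(4) using c r(1) by algebra
      moreover have "(x \<otimes> r) \<otimes> y \<in> P"
        using AB ideal_prod.prod[OF Ac(6)[OF s(3) r(1)] t(3), of R] by blast
      moreover have "p \<otimes> (r \<otimes> t) \<in> P" "(x \<otimes> r) \<otimes> q \<in> P"
        using Pc(5)[OF t(2)] Pc(6)[OF s(2)] c r(1) by auto
      ultimately have "s \<otimes> r \<otimes> t \<in> P" by (simp add: Pc(3))
      then show False using r(2) P by auto
    qed
  qed
  then show ?thesis using P by blast
qed

lemma torsion_quotients_imp_power_mem:
  assumes torsion: "\<And>P. \<lbrakk>two_sided_primeideal P R; I \<subseteq> P\<rbrakk> \<Longrightarrow> torsion_ring (R Quot P)"
    and I: "ideal I R" and a: "a \<in> carrier R"
  shows "\<exists>n>0. \<exists>k. (a [^] (n::nat)) [^] (k::nat) \<otimes> (\<one> \<ominus> a [^] n) [^] k \<in> I"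
proof -
  define X :: "int poly" where "X = [:0, 1:]"
  have X: "int_poly_eval a X = a" using a by (simp add: X_def)
  \<comment> \<open>The factorial makes \<open>1 - X^m\<close> divide \<open>D j\<close> for all
    \<open>0 < m \<le> j\<close>; the outer powers \<open>j\<close> leave room for the product of
    \<open>D i\<close> and \<open>D j\<close> to divide \<open>D (i + j)\<close>.\<close>
  define D where "D j = X ^ j * (1 - X ^ fact j) ^ j" for j :: nat
  have dvd: "1 - X ^ m dvd 1 - X ^ n" if mn: "m dvd n" for m n
  proof -
    obtain l where "n = m * l" using mn by (rule dvdE)
    then show ?thesis using one_diff_power_eq[of "X ^ m" l] by (simp add: power_mult)
  qed
  have D_mult: "D i * D j dvd D (i + j)" for i j
  proof -
    have "fact i dvd (fact (i + j) :: nat)" "fact j dvd (fact (i + j) :: nat)"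
      by (simp_all add: fact_dvd)
    then have "(1 - X ^ fact i) ^ i * (1 - X ^ fact j) ^ j
        dvd (1 - X ^ fact (i + j)) ^ i * (1 - X ^ fact (i + j)) ^ j"
      by (intro mult_dvd_mono dvd_power_same dvd)
    then have "(1 - X ^ fact i) ^ i * (1 - X ^ fact j) ^ j dvd (1 - X ^ fact (i + j)) ^ (i + j)"
      by (simp only: power_add)
    then have "X ^ (i + j) * ((1 - X ^ fact i) ^ i * (1 - X ^ fact j) ^ j) dvd D (i + j)"
      unfolding D_def by (rule mult_dvd_mono[OF dvd_refl])
    then show ?thesis by (simp only: D_def power_add mult_ac)
  qed
  have "\<exists>j. int_poly_eval a (D j) \<in> I"
  proof (rule ccontr)
    assume none: "\<nexists>j. int_poly_eval a (D j) \<in> I"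
    let ?S = "range (\<lambda>j. int_poly_eval a (D j))"
    have "\<exists>r\<in>carrier R. s \<otimes> r \<otimes> t \<in> ?S" if st: "s \<in> ?S" "t \<in> ?S" for s t
    proof -
      obtain i j where s: "s = int_poly_eval a (D i)" and t: "t = int_poly_eval a (D j)"
        using st by blast
      obtain q where "D (i + j) = D i * D j * q" using D_mult by (rule dvdE)
      \<comment> \<open>The cofactor is moved to the middle, where its value serves as the
        \<open>r\<close> of the m-system condition.\<close>
      then have "D (i + j) = D i * q * D j" by (simp only: mult_ac)
      then have "s \<otimes> int_poly_eval a q \<otimes> t = int_poly_eval a (D (i + j))"
        using a by (simp add: s t int_poly_eval_mult)
      then have "s \<otimes> int_poly_eval a q \<otimes> t \<in> ?S" by blast
      then show ?thesis using a by (intro bexI[of _ "int_poly_eval a q"]) auto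
    qed
    moreover have "?S \<subseteq> carrier R" "?S \<noteq> {}" "?S \<inter> I = {}" using none a by auto
    ultimately obtain P where P: "two_sided_primeideal P R" "I \<subseteq> P" "?S \<inter> P = {}"
      using m_system_prime_exists[OF I, of ?S] by blast
    have P_ideal: "ideal P R" using P(1) by (rule two_sided_primeideal.axioms)
    have notin: "int_poly_eval a (D j) \<notin> P" for j using P(3) by blast
    show False
    proof (cases "a \<in> P")
      case True
      have "X dvd D 1" by (simp add: D_def)
      then show ?thesis
        using int_poly_eval_dvd[OF a P_ideal, of X "D 1"] True notin by (simp add: X)
    next
      case False
      then obtain m :: nat where m: "m > 0" "a [^] m \<ominus> \<one> \<in> P"
        using torsion[OF P(1,2)] torsion_Quot_iff[OF P_ideal] a by auto
      have "\<one> \<ominus> a [^] m = \<ominus> \<one> \<otimes> (a [^] m \<ominus> \<one>)" using a by (simp add: ring_simprules)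
      then have "int_poly_eval a (1 - X ^ m) \<in> P"
        using ideal_closed(5)[OF P_ideal m(2), of "\<ominus> \<one>"] a by (simp add: int_poly_eval_simps X)
      moreover have "1 - X ^ m dvd D m"
      proof -
        have "1 - X ^ m dvd 1 - X ^ fact m" using m(1) by (intro dvd dvd_fact) auto
        also have "\<dots> dvd (1 - X ^ fact m) ^ m" using m(1) by (intro dvd_power) simp
        also have "\<dots> dvd D m" by (simp add: D_def)
        finally show ?thesis .
      qed
      ultimately show ?thesis using int_poly_eval_dvd[OF a P_ideal] notin by blast
    qed
  qed
  then obtain j where j: "int_poly_eval a (D j) \<in> I" by blast
  \<comment> \<open>The factor \<open>X^j\<close> is enlarged to \<open>(X^j!)^j\<close>, so that
    the whole expression is one in \<open>a^j!\<close>.\<close>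
  have "X dvd X ^ fact j" by (intro dvd_power) simp
  then have "D j dvd (X ^ fact j) ^ j * (1 - X ^ fact j) ^ j"
    unfolding D_def by (intro mult_dvd_mono[OF dvd_power_same dvd_refl])
  then have "(a [^] (fact j :: nat)) [^] j \<otimes> (\<one> \<ominus> a [^] (fact j :: nat)) [^] j \<in> I"
    using int_poly_eval_dvd[OF a I j, of "(X ^ fact j) ^ j * (1 - X ^ fact j) ^ j"] a
    by (simp add: int_poly_eval_simps X)
  moreover have "(fact j :: nat) > 0" by simp
  ultimately show ?thesis by blast
qed

text \<open>Chinese remaindering in integer polynomials: \<open>H\<close> is \<open>0\<close> modulo
  \<open>X^k\<close> and \<open>1\<close> modulo \<open>(1 - X)^k\<close>, so its value at
  \<open>b\<close> is idempotent modulo the radical and can be lifted.\<close>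

lemma idempotent_splitting:
  assumes lift: "idempotents_lift_mod_radical R" and b: "b \<in> carrier R"
    and mem: "b [^] (k::nat) \<otimes> (\<one> \<ominus> b) [^] k \<in> jacobson_radical R"
  shows "\<exists>e\<in>idempotents R. e \<otimes> (\<one> \<ominus> b) [^] k \<in> jacobson_radical R
    \<and> (\<one> \<ominus> e) \<otimes> b [^] k \<in> jacobson_radical R"
proof -
  define X :: "int poly" where "X = [:0, 1:]"
  have X: "int_poly_eval b X = b" using b by (simp add: X_def)
  \<comment> \<open>\<open>X\<^sup>k\<close> divides \<open>H\<close> and \<open>(1 - X)\<^sup>k\<close> divides \<open>1 - H\<close>, so \<open>H\<close> is idempotent modulo \<open>X\<^sup>k (1 - X)\<^sup>k\<close>\<close>
  define H where "H = (1 - (1 - X) ^ k) ^ k"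
  define \<eta> where "\<eta> = int_poly_eval b H"
  have \<eta>: "\<eta> \<in> carrier R" using b by (simp add: \<eta>_def)
  have "X dvd 1 - (1 - X) ^ k"
    using one_diff_power_eq[of "1 - X" k] by simp
  then have H: "X ^ k dvd H" unfolding H_def by (rule dvd_power_same)
  have H': "(1 - X) ^ k dvd 1 - H"
    using one_diff_power_eq[of "1 - (1 - X) ^ k" k] by (simp add: H_def)
  have base: "int_poly_eval b (X ^ k * (1 - X) ^ k) \<in> jacobson_radical R"
    using mem b by (simp add: int_poly_eval_simps X)
  note eval = int_poly_eval_dvd[OF b ideal_jacobson_radical base]
  have 1: "\<eta> \<otimes> (\<one> \<ominus> b) [^] k \<in> jacobson_radical R"
    using eval[OF mult_dvd_mono[OF H dvd_refl]] b by (simp add: \<eta>_def int_poly_eval_simps X)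
  have 2: "(\<one> \<ominus> \<eta>) \<otimes> b [^] k \<in> jacobson_radical R"
  proof -
    have "X ^ k * (1 - X) ^ k dvd (1 - H) * X ^ k"
      unfolding mult.commute[of "X ^ k"] using H' by (intro mult_dvd_mono) auto
    from eval[OF this] show ?thesis using b by (simp add: \<eta>_def int_poly_eval_simps X)
  qed
  have "\<eta> \<otimes> (\<one> \<ominus> \<eta>) \<in> jacobson_radical R"
    using eval[OF mult_dvd_mono[OF H H']] b by (simp add: \<eta>_def int_poly_eval_simps)
  moreover have "\<eta> \<otimes> (\<one> \<ominus> \<eta>) = \<eta> \<ominus> \<eta> [^] (2::nat)"
    using \<eta> by (simp add: numeral_2_eq_2 ring_simprules)
  ultimately obtain e where e: "e \<in> idempotents R" "\<eta> \<ominus> e \<in> jacobson_radical R"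
    using lift \<eta> unfolding idempotents_lift_mod_radical_def by auto
  have ec: "e \<in> carrier R" using e by (simp add: idempotents_def)
  \<comment> \<open>Replacing \<open>\<eta>\<close> by \<open>e\<close> alters either product only
    by a multiple of \<open>\<eta> \<ominus> e\<close>, which lies in the radical.\<close>
  have "e \<otimes> (\<one> \<ominus> b) [^] k = \<eta> \<otimes> (\<one> \<ominus> b) [^] k \<ominus> (\<eta> \<ominus> e) \<otimes> (\<one> \<ominus> b) [^] k"
  proof -
    have "\<eta> \<otimes> y \<ominus> (\<eta> \<ominus> e) \<otimes> y = e \<otimes> y" if "y \<in> carrier R" for y
      using that \<eta> ec by algebra
    then show ?thesis using b by simp
  qed
  moreover have "(\<one> \<ominus> e) \<otimes> b [^] k = (\<one> \<ominus> \<eta>) \<otimes> b [^] k \<oplus> (\<eta> \<ominus> e) \<otimes> b [^] k"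
  proof -
    have "(\<one> \<ominus> \<eta>) \<otimes> y \<oplus> (\<eta> \<ominus> e) \<otimes> y = (\<one> \<ominus> e) \<otimes> y" if "y \<in> carrier R" for y
      using that \<eta> ec by algebra
    then show ?thesis using b by simp
  qed
  ultimately show ?thesis
    using jr_closed(4)[OF 1 jr_closed(6)[OF e(2)]] jr_closed(3)[OF 2 jr_closed(6)[OF e(2)]] b
    by (intro bexI[OF _ e(1)]) simp
qed

end

subsection \<open>Rings with central idempotents\<close>

locale central_idempotents_ring = ring +
  assumes abelian: "abelian_ring R"
begin

lemma idempotent_carrier: "e \<in> idempotents R \<Longrightarrow> e \<in> carrier R"
  by (simp add: idempotents_def)

lemma idempotent_square: "e \<in> idempotents R \<Longrightarrow> e \<otimes> e = e"
  by (simp add: idempotents_def)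

lemma idempotent_central: "\<lbrakk>e \<in> idempotents R; x \<in> carrier R\<rbrakk> \<Longrightarrow> x \<otimes> e = e \<otimes> x"
  using abelian unfolding abelian_ring_def by metis

lemma idempotent_compl:
  assumes "e \<in> idempotents R"
  shows "\<one> \<ominus> e \<in> idempotents R"
proof -
  have e: "e \<in> carrier R" "e \<otimes> e = e" using assms by (auto simp: idempotents_def)
  have "(\<one> \<ominus> e) \<otimes> (\<one> \<ominus> e) = \<one> \<ominus> e \<ominus> (e \<ominus> e \<otimes> e)"
    using e(1) by (simp add: ring_simprules)
  also have "\<dots> = \<one> \<ominus> e"
    unfolding e(2) using e(1) by (simp add: ring_simprules)
  finally show ?thesis using e(1) by (simp add: idempotents_def)
qed

lemma idempotent_mult:
  assumes "e \<in> idempotents R" "f \<in> idempotents R"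
  shows "e \<otimes> f \<in> idempotents R"
proof -
  note c = assms[THEN idempotent_carrier]
  have "(e \<otimes> f) \<otimes> (e \<otimes> f) = e \<otimes> (f \<otimes> e) \<otimes> f" using c by (simp add: m_assoc)
  also have "\<dots> = (e \<otimes> e) \<otimes> (f \<otimes> f)"
    unfolding idempotent_central[OF assms(1) c(2)] using c by (simp only: m_assoc m_closed)
  finally show ?thesis using c assms by (simp add: idempotents_def)
qed

text \<open>Since \<open>c\<close> is central, multiplication by \<open>c\<close> is a ring
  homomorphism onto the corner \<open>cR\<close>, so elements with equal images have powers with
  equal images.\<close>

lemma idempotent_mult_pow_cong:
  assumes c: "c \<in> idempotents R" and x: "x \<in> carrier R" "y \<in> carrier R"
    and eq: "c \<otimes> x = c \<otimes> y"
  shows "c \<otimes> x [^] (k::nat) = c \<otimes> y [^] k"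
proof (induction k)
  case (Suc k)
  note cc = idempotent_carrier[OF c]
  have "c \<otimes> x [^] Suc k = (c \<otimes> x [^] k) \<otimes> x" using x cc by (simp add: m_assoc)
  also have "\<dots> = (y [^] k \<otimes> c) \<otimes> x"
    using Suc x by (simp add: idempotent_central[OF c, of "y [^] k"])
  also have "\<dots> = y [^] k \<otimes> (c \<otimes> y)" unfolding eq[symmetric] using x cc by (simp add: m_assoc)
  also have "\<dots> = (y [^] k \<otimes> c) \<otimes> y" using x cc by (simp add: m_assoc)
  also have "\<dots> = c \<otimes> y [^] Suc k"
    using x cc by (simp add: m_assoc idempotent_central[OF c, of "y [^] k"])
  finally show ?case .
qed simp

text \<open>The exponent is positive because for exponent \<open>0\<close> the left side is
  \<open>\<one>\<close> and the right side is \<open>c\<close>.\<close>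

lemma idempotent_mult_power:
  assumes c: "c \<in> idempotents R" and x: "x \<in> carrier R"
  shows "(c \<otimes> x) [^] Suc k = c \<otimes> x [^] Suc k"
proof -
  note cc = idempotent_carrier[OF c]
  have "c \<otimes> (c \<otimes> x) = c \<otimes> x" using cc x by (simp add: idempotent_square[OF c] flip: m_assoc)
  then have *: "c \<otimes> (c \<otimes> x) [^] k = c \<otimes> x [^] k"
    by (rule idempotent_mult_pow_cong[OF c m_closed[OF cc x] x])
  have "(c \<otimes> x) [^] Suc k = ((c \<otimes> x) [^] k \<otimes> c) \<otimes> x" using cc x by (simp add: m_assoc)
  also have "\<dots> = (c \<otimes> x [^] k) \<otimes> x" using * cc x by (simp add: idempotent_central[OF c, of "(c \<otimes> x) [^] k"])
  finally show ?thesis using cc x by (simp add: m_assoc)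
qed

text \<open>Cancelling the unit \<open>w^k\<close> puts \<open>c\<close> into the radical, whose
  only idempotent is zero: a unit is not nilpotent modulo the radical on a nonzero corner.\<close>

lemma idempotent_Unit_power_mem:
  assumes c: "c \<in> idempotents R" and w: "w \<in> Units R"
    and mem: "c \<otimes> w [^] (k::nat) \<in> jacobson_radical R"
  shows "c = \<zero>"
proof -
  have wk: "w [^] k \<in> Units R" using w by (induction k) auto
  have "c = (c \<otimes> w [^] k) \<otimes> inv (w [^] k)"
    using wk Units_closed[OF w] idempotent_carrier[OF c] by (simp add: m_assoc)
  then have "c \<in> jacobson_radical R" using jr_closed(6)[OF mem Units_inv_closed[OF wk]] by simp
  then show ?thesis by (rule idempotent_jacobson_radical[OF c])
qed

lemma idempotent_split_eqI:
  assumes e: "e \<in> idempotents R" and x: "x \<in> carrier R" "y \<in> carrier R"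
    and eq: "e \<otimes> x = e \<otimes> y" "(\<one> \<ominus> e) \<otimes> x = (\<one> \<ominus> e) \<otimes> y"
  shows "x = y"
proof -
  have "z = e \<otimes> z \<oplus> (\<one> \<ominus> e) \<otimes> z" if "z \<in> carrier R" for z
    using idempotent_carrier[OF e] that by (simp add: ring_simprules)
  from this[OF x(1)] this[OF x(2)] show ?thesis unfolding eq by (rule trans[OF _ sym])
qed

text \<open>With \<open>d = 1 - e\<close>, the element \<open>b - d\<close> acts as \<open>b\<close>
  on \<open>eR\<close> and as \<open>-(1 - b)\<close> on \<open>dR\<close>. Both are invertible
  there, since \<open>1 - b\<close> and \<open>b\<close> respectively are nilpotent modulo the
  radical.\<close>

lemma uniquely_clean_of_splitting:
  assumes e: "e \<in> idempotents R" and b: "b \<in> carrier R"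
    and mem1: "e \<otimes> (\<one> \<ominus> b) [^] (k::nat) \<in> jacobson_radical R"
    and mem2: "(\<one> \<ominus> e) \<otimes> b [^] k \<in> jacobson_radical R"
  shows "uniquely_clean R b"
proof -
  note ec = idempotent_carrier[OF e] and ee = idempotent_square[OF e]
  note e' = idempotent_compl[OF e]
  \<comment> \<open>The exponent is raised by one because \<open>idempotent_mult_power\<close> needs
    it positive, while \<open>k\<close> may be \<open>0\<close>.\<close>
  have mem: "x \<otimes> y [^] Suc k \<in> jacobson_radical R"
    if "x \<otimes> y [^] k \<in> jacobson_radical R" "x \<in> carrier R" "y \<in> carrier R" for x y
    using jr_closed(6)[OF that(1,3)] that(2,3) by (simp add: m_assoc)
  have u1: "\<one> \<ominus> e \<otimes> (\<one> \<ominus> b) \<in> Units R"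
    using mem[OF mem1 ec] b ec idempotent_mult_power[OF e, of "\<one> \<ominus> b" k]
    by (intro one_minus_Unit_of_power_mem[where k = "Suc k"]) (simp_all only: m_closed minus_closed one_closed)
  have u2: "\<one> \<ominus> (\<one> \<ominus> e) \<otimes> b \<in> Units R"
    using mem[OF mem2 minus_closed[OF one_closed ec] b] b ec idempotent_mult_power[OF e' b, of k]
    by (intro one_minus_Unit_of_power_mem[where k = "Suc k"]) (simp_all only: m_closed minus_closed one_closed)
  define d z where "d = \<one> \<ominus> e" and "z = \<one> \<ominus> b"
  have dc: "d \<in> carrier R" and zc: "z \<in> carrier R" using ec b by (auto simp: d_def z_def)
  have dd: "d \<otimes> d = d" using idempotent_square[OF e'] by (simp add: d_def)
  have e_d: "e \<oplus> d = \<one>" using ec a_lcomm[of e \<one> "\<ominus> e"] by (simp add: d_def minus_eq r_neg)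
  have ed: "e \<otimes> d = \<zero>" using ec ee by (simp add: d_def ring_simprules)
  have de: "d \<otimes> e = \<zero>" using ec ee by (simp add: d_def ring_simprules)
  have absorb: "e \<otimes> (e \<otimes> x) = e \<otimes> x" "d \<otimes> (d \<otimes> x) = d \<otimes> x"
    "e \<otimes> (d \<otimes> x) = \<zero>" "d \<otimes> (e \<otimes> x) = \<zero>" if "x \<in> carrier R" for x
    using that ec dc by (simp_all add: ee dd ed de flip: m_assoc)
  have comm: "x \<otimes> e = e \<otimes> x" "x \<otimes> d = d \<otimes> x" if "x \<in> carrier R" for x
    using idempotent_central[OF e that] idempotent_central[OF e' that] by (simp_all add: d_def)
  have lcomm: "b \<otimes> (e \<otimes> x) = e \<otimes> (b \<otimes> x)" "b \<otimes> (d \<otimes> x) = d \<otimes> (b \<otimes> x)"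
    if "x \<in> carrier R" for x
    using that ec dc b comm[OF b] by (simp_all flip: m_assoc)
  \<comment> \<open>This unit is its own inverse and supplies the sign change on
    \<open>dR\<close>.\<close>
  have u3: "e \<ominus> d \<in> Units R"
  proof -
    have "(e \<ominus> d) \<otimes> (e \<ominus> d) = e \<oplus> d"
      using ec dc by (simp add: ring_simprules ee dd ed de)
    then show ?thesis using ec dc e_d unfolding Units_def by auto
  qed
  have u1': "\<one> \<ominus> e \<otimes> (\<one> \<ominus> b) = d \<oplus> e \<otimes> b"
    using ec b by (simp add: d_def ring_simprules)
  have u2': "\<one> \<ominus> (\<one> \<ominus> e) \<otimes> b = e \<oplus> d \<otimes> z"
  proof -
    have "e \<oplus> d \<otimes> z = (e \<oplus> d) \<ominus> d \<otimes> b"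
      unfolding z_def using ec dc b by (simp add: ring_simprules)
    then show ?thesis unfolding e_d d_def[symmetric] by simp
  qed
  \<comment> \<open>On \<open>eR\<close> the three factors act as \<open>b\<close>,
    \<open>1\<close>, \<open>1\<close>, and on \<open>dR\<close> as \<open>1\<close>,
    \<open>z\<close>, \<open>-1\<close>.\<close>
  have prod: "(d \<oplus> e \<otimes> b) \<otimes> ((e \<oplus> d \<otimes> z) \<otimes> (e \<ominus> d)) = b \<ominus> d"
  proof -
    have "(d \<oplus> e \<otimes> b) \<otimes> ((e \<oplus> d \<otimes> z) \<otimes> (e \<ominus> d)) = e \<otimes> b \<ominus> d \<otimes> z"
      using ec dc b zc by (simp add: ring_simprules ee dd ed de absorb comm(1,2)[OF b] comm(1,2)[OF zc] lcomm)
    also have "\<dots> = (e \<oplus> d) \<otimes> b \<ominus> d"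
      unfolding z_def using ec dc b by (simp add: ring_simprules)
    finally show ?thesis unfolding e_d using b by simp
  qed
  have u: "b \<ominus> (\<one> \<ominus> e) \<in> Units R"
    using Units_m_closed[OF u1 Units_m_closed[OF u2 u3]] unfolding u1' u2' prod by (simp only: d_def)
  \<comment> \<open>On \<open>gR\<close> the element \<open>1 - b\<close> acts as the unit
    \<open>-w\<close>, and on \<open>(1 - g)R\<close> the element \<open>b\<close> acts as
    \<open>w\<close>. Hence the corners of \<open>e g\<close> and of \<open>(1 - e)(1 - g)\<close>
    carry an element that is both a unit and nilpotent modulo the radical, so both idempotents
    vanish and \<open>g = 1 - e\<close>.\<close>
  have uniq: "g = \<one> \<ominus> e" if g: "g \<in> idempotents R" and w: "w \<in> Units R" and bgw: "b = g \<oplus> w" for g w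
  proof -
    note gc = idempotent_carrier[OF g] and gg = idempotent_square[OF g] and wc = Units_closed[OF w]
    note g' = idempotent_compl[OF g]
    have "g \<otimes> (\<one> \<ominus> b) = g \<otimes> (\<ominus> w)"
      unfolding bgw using gc wc by (simp add: ring_simprules gg)
    from idempotent_mult_pow_cong[OF g _ _ this, of k]
    have "g \<otimes> (\<one> \<ominus> b) [^] k = g \<otimes> (\<ominus> w) [^] k" using b wc by simp
    then have "(e \<otimes> g) \<otimes> (\<ominus> w) [^] k = (e \<otimes> g) \<otimes> (\<one> \<ominus> b) [^] k"
      using ec gc wc b by (simp add: m_assoc)
    also have "\<dots> = g \<otimes> (e \<otimes> (\<one> \<ominus> b) [^] k)"
      unfolding idempotent_central[OF g ec] using ec gc b by (simp add: m_assoc)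
    finally have "(e \<otimes> g) \<otimes> (\<ominus> w) [^] k \<in> jacobson_radical R"
      using jr_closed(5)[OF mem1 gc] by simp
    moreover have "\<ominus> w \<in> Units R"
      using Units_m_closed[OF Units_minus_one_closed w] wc by (simp add: l_minus)
    ultimately have 1: "e \<otimes> g = \<zero>"
      using idempotent_Unit_power_mem idempotent_mult[OF e g] by blast
    have "(\<one> \<ominus> g) \<otimes> b = (\<one> \<ominus> g) \<otimes> w"
      unfolding bgw using gc wc by (simp add: ring_simprules gg)
    from idempotent_mult_pow_cong[OF g' b wc this, of k]
    have "((\<one> \<ominus> e) \<otimes> (\<one> \<ominus> g)) \<otimes> w [^] k = (\<one> \<ominus> e) \<otimes> (\<one> \<ominus> g) \<otimes> b [^] k"
      using ec gc wc b by (simp add: m_assoc)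
    also have "\<dots> = (\<one> \<ominus> g) \<otimes> ((\<one> \<ominus> e) \<otimes> b [^] k)"
      unfolding idempotent_central[OF g' minus_closed[OF one_closed ec]]
      using ec gc b by (simp add: m_assoc)
    finally have "((\<one> \<ominus> e) \<otimes> (\<one> \<ominus> g)) \<otimes> w [^] k \<in> jacobson_radical R"
      using jr_closed(5)[OF mem2 minus_closed[OF one_closed gc]] by simp
    then have 2: "(\<one> \<ominus> e) \<otimes> (\<one> \<ominus> g) = \<zero>"
      by (rule idempotent_Unit_power_mem[OF idempotent_mult[OF e' g'] w])
    show ?thesis
    proof (rule idempotent_split_eqI[OF e gc])
      show "e \<otimes> g = e \<otimes> (\<one> \<ominus> e)" using 1 ed by (simp add: d_def)
      have "d \<otimes> g = d \<ominus> d \<otimes> (\<one> \<ominus> g)" using dc gc by (simp add: ring_simprules)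
      then show "(\<one> \<ominus> e) \<otimes> g = (\<one> \<ominus> e) \<otimes> (\<one> \<ominus> e)"
        using 2 dd dc by (simp add: d_def minus_eq)
    qed (use ec in simp)
  qed
  show ?thesis unfolding uniquely_clean_def
  proof (rule ex1I[of _ "(\<one> \<ominus> e, b \<ominus> (\<one> \<ominus> e))"])
    have "b = (\<one> \<ominus> e) \<oplus> (b \<ominus> (\<one> \<ominus> e))" using b ec by (simp add: ring_simprules)
    then show "(\<one> \<ominus> e, b \<ominus> (\<one> \<ominus> e)) \<in> idempotents R \<times> Units R
      \<and> b = fst (\<one> \<ominus> e, b \<ominus> (\<one> \<ominus> e)) \<oplus> snd (\<one> \<ominus> e, b \<ominus> (\<one> \<ominus> e))"
      using u e' by simp
    fix p assume p: "p \<in> idempotents R \<times> Units R \<and> b = fst p \<oplus> snd p"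
    obtain g w where gw: "p = (g, w)" by (cases p)
    with p have g: "g \<in> idempotents R" "w \<in> Units R" "b = g \<oplus> w" by auto
    have "w = b \<ominus> g"
      unfolding g(3) using Units_closed[OF g(2)] idempotent_carrier[OF g(1)] by algebra
    then show "p = (\<one> \<ominus> e, b \<ominus> (\<one> \<ominus> e))" unfolding gw using uniq[OF g] by simp
  qed
qed

lemma uniquely_pi_cleanI:
  assumes lift: "idempotents_lift_mod_radical R"
    and torsion: "\<And>P. \<lbrakk>two_sided_primeideal P R; jacobson_radical R \<subseteq> P\<rbrakk> \<Longrightarrow> torsion_ring (R Quot P)"
  shows "uniquely_pi_clean R"
  unfolding uniquely_pi_clean_def
proof
  fix a assume a: "a \<in> carrier R"
  obtain n k :: nat where n: "n > 0"
    and mem: "(a [^] n) [^] k \<otimes> (\<one> \<ominus> a [^] n) [^] k \<in> jacobson_radical R"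
    using torsion_quotients_imp_power_mem[OF torsion ideal_jacobson_radical a] by blast
  obtain e where "e \<in> idempotents R" "e \<otimes> (\<one> \<ominus> a [^] n) [^] k \<in> jacobson_radical R"
    "(\<one> \<ominus> e) \<otimes> (a [^] n) [^] k \<in> jacobson_radical R"
    using idempotent_splitting[OF lift nat_pow_closed[OF a] mem] by blast
  then have "uniquely_clean R (a [^] n)"
    using a by (intro uniquely_clean_of_splitting) auto
  then show "\<exists>n::nat. n > 0 \<and> uniquely_clean R (a [^] n)" using n by blast
qed

end

subsection \<open>Uniquely \<open>\<pi>\<close>-clean rings\<close>

context ring
begin

lemma eq_of_minus_zero:
  assumes "a \<in> carrier R" "b \<in> carrier R" "a \<ominus> b = \<zero>"
  shows "a = b"
proof -
  have "a = (a \<ominus> b) \<oplus> b" using assms(1,2) by algebra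
  then show ?thesis using assms by simp
qed

lemma uniquely_cleanD:
  assumes "uniquely_clean R x"
  shows "\<exists>e\<in>idempotents R. \<exists>u\<in>Units R. x = e \<oplus> u \<and>
    (\<forall>e'\<in>idempotents R. \<forall>u'\<in>Units R. x = e' \<oplus> u' \<longrightarrow> e' = e)"
proof -
  from assms obtain p where p: "p \<in> idempotents R \<times> Units R \<and> x = fst p \<oplus> snd p"
    and uniq: "\<forall>q. q \<in> idempotents R \<times> Units R \<and> x = fst q \<oplus> snd q \<longrightarrow> q = p"
    unfolding uniquely_clean_def by (rule ex1E)
  have "e' = fst p" if "e' \<in> idempotents R" "u' \<in> Units R" "x = e' \<oplus> u'" for e' u'
    using uniq[rule_format, of "(e', u')"] that by auto
  with p show ?thesis by (intro bexI[of _ "fst p"] bexI[of _ "snd p"]) auto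
qed

text \<open>
  Writing \<open>d = 1 - e\<close>, the two clean decompositions \<open>e = d + (e - d) = (d - y) + (e - d + y)\<close> must
  coincide; both unit parts square to \<open>1\<close>.
\<close>

lemma idempotent_off_diagonal_zero:
  assumes e: "e \<in> idempotents R" and clean: "uniquely_clean R e"
    and y: "y \<in> carrier R" "e \<otimes> y = y" "y \<otimes> e = \<zero>"
  shows "y = \<zero>"
proof -
  have ec: "e \<in> carrier R" and ee: "e \<otimes> e = e" using e by (auto simp: idempotents_def)
  define d where "d = \<one> \<ominus> e"
  have dc: "d \<in> carrier R" using ec by (simp add: d_def)
  have ed: "e \<otimes> d = \<zero>" "d \<otimes> e = \<zero>" using ec ee by (simp_all add: d_def ring_simprules)
  have dd: "d \<otimes> d = d" using ec ee by (simp add: d_def ring_simprules)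
  have dy: "d \<otimes> y = \<zero>" "y \<otimes> d = y" using ec y by (simp_all add: d_def ring_simprules)
  have yy: "y \<otimes> y = \<zero>"
  proof -
    have "y \<otimes> y = (y \<otimes> e) \<otimes> y" using m_assoc[OF y(1) ec y(1)] y(2) by simp
    then show ?thesis using y by simp
  qed
  have e_d: "e \<oplus> d = \<one>" using ec a_lcomm[of e \<one> "\<ominus> e"] by (simp add: d_def minus_eq r_neg)
  have unit: "x \<in> Units R" if "x \<in> carrier R" "x \<otimes> x = \<one>" for x
    using that unfolding Units_def by blast
  have 1: "d \<in> idempotents R" "e \<ominus> d \<in> Units R" "e = d \<oplus> (e \<ominus> d)"
  proof -
    have "(e \<ominus> d) \<otimes> (e \<ominus> d) = e \<oplus> d" using ec dc by (simp add: ring_simprules ee dd ed)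
    then show "e \<ominus> d \<in> Units R" using unit ec dc e_d by simp
    show "e = d \<oplus> (e \<ominus> d)" using ec dc a_lcomm[of d e "\<ominus> d"] by (simp add: minus_eq r_neg)
  qed (use dc dd in \<open>auto simp: idempotents_def\<close>)
  have 2: "d \<ominus> y \<in> idempotents R" "(e \<ominus> d) \<oplus> y \<in> Units R" "e = (d \<ominus> y) \<oplus> ((e \<ominus> d) \<oplus> y)"
  proof -
    have "((e \<ominus> d) \<oplus> y) \<otimes> ((e \<ominus> d) \<oplus> y) = (e \<ominus> d) \<otimes> (e \<ominus> d)"
    proof -
      \<comment> \<open>\<open>e - d\<close> fixes \<open>y\<close> from the left and negates it
        from the right, so the cross terms of the square cancel.\<close>
      have "(e \<ominus> d) \<otimes> y = y" "y \<otimes> (e \<ominus> d) = \<ominus> y"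
        using ec dc y dy by (simp_all add: ring_simprules)
      then have "((e \<ominus> d) \<oplus> y) \<otimes> ((e \<ominus> d) \<oplus> y) = (e \<ominus> d) \<otimes> (e \<ominus> d) \<oplus> (\<ominus> y \<oplus> (y \<oplus> y \<otimes> y))"
        using ec dc y(1) by (simp add: l_distr r_distr a_assoc)
      then show ?thesis using ec dc y(1) yy by (simp add: l_neg)
    qed
    also have "\<dots> = \<one>" using ec dc e_d by (simp add: ring_simprules ee dd ed)
    finally show "(e \<ominus> d) \<oplus> y \<in> Units R" using unit ec dc y(1) by simp
    have "(d \<ominus> y) \<otimes> (d \<ominus> y) = d \<ominus> y"
      using dc y dy dd yy by (simp add: ring_simprules)
    then show "d \<ominus> y \<in> idempotents R" using dc y(1) by (simp add: idempotents_def)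
    have "(d \<ominus> y) \<oplus> ((e \<ominus> d) \<oplus> y) = (d \<oplus> (e \<ominus> d)) \<oplus> (y \<oplus> \<ominus> y)"
      using ec dc y(1) by (simp add: minus_eq a_ac)
    then show "e = (d \<ominus> y) \<oplus> ((e \<ominus> d) \<oplus> y)"
      using 1(3) ec y(1) by (simp add: r_neg)
  qed
  obtain e' where "\<forall>f\<in>idempotents R. \<forall>v\<in>Units R. e = f \<oplus> v \<longrightarrow> f = e'"
    using uniquely_cleanD[OF clean] by blast
  with 1 2 have "d \<ominus> y = d" by metis
  then have "d \<ominus> (d \<ominus> y) = \<zero>" using dc by (simp add: r_neg minus_eq)
  moreover have "d \<ominus> (d \<ominus> y) = y" using dc y(1) by algebra
  ultimately show ?thesis by simp
qed

text \<open>An idempotent equals all its positive powers, so it is itself uniquely clean. The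
  off-diagonal elements \<open>e x (1 - e)\<close> therefore vanish, and so do
  \<open>(1 - e) x e\<close> by symmetry; together \<open>ex = exe = xe\<close>.\<close>

lemma uniquely_pi_clean_imp_abelian:
  assumes U: "uniquely_pi_clean R"
  shows "abelian_ring R"
proof -
  have clean: "uniquely_clean R e" if e: "e \<in> idempotents R" for e
  proof -
    have ec: "e \<in> carrier R" "e \<otimes> e = e" using e by (auto simp: idempotents_def)
    obtain n :: nat where n: "n > 0" "uniquely_clean R (e [^] n)"
      using U ec unfolding uniquely_pi_clean_def by blast
    have "e [^] Suc k = e" for k by (induction k) (use ec in auto)
    then have "e [^] n = e" using n(1) by (metis gr0_implies_Suc)
    then show ?thesis using n(2) by simp
  qed
  have key: "e \<otimes> x = e \<otimes> x \<otimes> e" if e: "e \<in> idempotents R" and x: "x \<in> carrier R" for e x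
  proof -
    have ec: "e \<in> carrier R" and ee: "e \<otimes> e = e" using e by (auto simp: idempotents_def)
    have ee': "e \<otimes> (e \<otimes> z) = e \<otimes> z" if "z \<in> carrier R" for z
      using ec ee that by (simp flip: m_assoc)
    have "e \<otimes> x \<ominus> e \<otimes> x \<otimes> e = \<zero>"
      by (rule idempotent_off_diagonal_zero[OF e clean[OF e]])
        (use ec x in \<open>simp_all add: ring_simprules ee ee'\<close>)
    then show ?thesis using eq_of_minus_zero[of "e \<otimes> x" "e \<otimes> x \<otimes> e"] ec x by simp
  qed
  have "e \<otimes> x = x \<otimes> e" if e: "e \<in> idempotents R" and x: "x \<in> carrier R" for e x
  proof -
    have ec: "e \<in> carrier R" and ee: "e \<otimes> e = e" using e by (auto simp: idempotents_def)
    define g where "g = \<one> \<ominus> e"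
    have gc: "g \<in> carrier R" using ec by (simp add: g_def)
    have "g \<in> idempotents R"
      using ec ee by (simp add: g_def idempotents_def ring_simprules)
    from key[OF this x] have "(g \<otimes> x) \<otimes> e = (g \<otimes> x \<otimes> g) \<otimes> e" by (rule arg_cong)
    also have "\<dots> = (g \<otimes> x) \<otimes> (g \<otimes> e)" using gc ec x by (simp add: m_assoc)
    also have "g \<otimes> e = \<zero>" using ec ee by (simp add: g_def ring_simprules)
    finally have "(g \<otimes> x) \<otimes> e = \<zero>" using gc x by simp
    moreover have "(g \<otimes> x) \<otimes> e = x \<otimes> e \<ominus> e \<otimes> x \<otimes> e"
      using ec x by (simp add: g_def ring_simprules)
    ultimately have "x \<otimes> e \<ominus> e \<otimes> x \<otimes> e = \<zero>" by simp
    then have "x \<otimes> e = e \<otimes> x \<otimes> e"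
      using eq_of_minus_zero[of "x \<otimes> e" "e \<otimes> x \<otimes> e"] ec x by simp
    then show ?thesis using key[OF e x] by simp
  qed
  then show ?thesis unfolding abelian_ring_def by blast
qed

end

section \<open>Invertibility on corners and idempotents in prime ideals\<close>

context central_idempotents_ring
begin

text \<open>Dedekind finiteness: \<open>xy\<close> is idempotent, hence central, so
  \<open>1 = y (xy) x = xy (yx) = xy\<close>.\<close>

lemma left_inverse_imp_Unit:
  assumes x: "x \<in> carrier R" "y \<in> carrier R" "y \<otimes> x = \<one>"
  shows "x \<in> Units R"
proof -
  have "(x \<otimes> y) \<otimes> (x \<otimes> y) = x \<otimes> (y \<otimes> x) \<otimes> y" using x(1,2) by (simp add: m_assoc)
  then have "x \<otimes> y \<in> idempotents R" using x by (simp add: idempotents_def)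
  from idempotent_central[OF this x(2)]
  have "y \<otimes> (x \<otimes> y) \<otimes> x = x \<otimes> y \<otimes> (y \<otimes> x)" using x(1,2) by (simp add: m_assoc)
  moreover have "y \<otimes> (x \<otimes> y) \<otimes> x = (y \<otimes> x) \<otimes> (y \<otimes> x)" using x(1,2) by (simp add: m_assoc)
  ultimately have "x \<otimes> y = \<one>" using x by simp
  then show ?thesis using x unfolding Units_def by blast
qed

text \<open>Serves to build left inverses piecewise: the pieces \<open>s c\<close>, taken over
  orthogonal idempotents \<open>c\<close> with sum \<open>\<one>\<close>, add up to a left inverse
  of \<open>x\<close>.\<close>

lemma corner_left_inverse:
  assumes c: "c \<in> idempotents R" and x: "x \<in> carrier R" "y \<in> carrier R" "s \<in> carrier R"
    and eq: "c \<otimes> x = c \<otimes> y" and inv: "c \<otimes> (s \<otimes> y) = c"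
  shows "(s \<otimes> c) \<otimes> x = c"
proof -
  note cc = idempotent_carrier[OF c]
  have "(s \<otimes> c) \<otimes> x = s \<otimes> (c \<otimes> y)" using cc x eq by (simp add: m_assoc)
  also have "\<dots> = (s \<otimes> c) \<otimes> y" using cc x by (simp add: m_assoc)
  also have "\<dots> = c \<otimes> (s \<otimes> y)"
    unfolding idempotent_central[OF c x(3)] using cc x by (simp add: m_assoc)
  finally show ?thesis using inv by simp
qed

text \<open>Replacing \<open>e\<close> by \<open>1 - e\<close> on \<open>fR\<close> gives an
  idempotent \<open>e'\<close>. The difference \<open>b - e'\<close> agrees with \<open>u\<close> on
  \<open>(1 - f)R\<close>, with \<open>b\<close> on \<open>efR\<close> and with \<open>b - 1\<close>
  on \<open>(1 - e)fR\<close>, and is invertible on each. So \<open>b = e' + (b - e')\<close> is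
  another clean decomposition, and uniqueness leaves only \<open>f = 0\<close>.\<close>

lemma uniquely_clean_idempotent_zero:
  assumes clean: "uniquely_clean R b" and b: "b \<in> carrier R" and f: "f \<in> idempotents R"
    and s: "s \<in> carrier R" "f \<otimes> (s \<otimes> b) = f"
    and t: "t \<in> carrier R" "f \<otimes> (t \<otimes> (b \<ominus> \<one>)) = f"
  shows "f = \<zero>"
proof -
  obtain e u where e: "e \<in> idempotents R" and u: "u \<in> Units R" and beu: "b = e \<oplus> u"
    and uniq: "\<forall>e'\<in>idempotents R. \<forall>u'\<in>Units R. b = e' \<oplus> u' \<longrightarrow> e' = e"
    using uniquely_cleanD[OF clean] by blast
  define d g where "d = \<one> \<ominus> e" and "g = \<one> \<ominus> f"
  note d = idempotent_compl[OF e, folded d_def] and g = idempotent_compl[OF f, folded g_def]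
  note c = idempotent_carrier[OF e] idempotent_carrier[OF f] idempotent_carrier[OF d]
    idempotent_carrier[OF g]
  note uc = Units_closed[OF u]
  have e_d: "e \<oplus> d = \<one>" using c(1) a_lcomm[of e \<one> "\<ominus> e"] by (simp add: d_def minus_eq r_neg)
  have f_g: "g \<oplus> f = \<one>" using c(2) by (simp add: g_def minus_eq a_assoc l_neg)
  note sq = idempotent_square[OF e] idempotent_square[OF f] idempotent_square[OF d]
    idempotent_square[OF g]
  have orth: "e \<otimes> d = \<zero>" "d \<otimes> e = \<zero>" "f \<otimes> g = \<zero>" "g \<otimes> f = \<zero>"
    using c(1,2) sq(1,2) by (simp_all add: d_def g_def ring_simprules)
  have comm: "f \<otimes> e = e \<otimes> f" "f \<otimes> d = d \<otimes> f" "g \<otimes> e = e \<otimes> g" "g \<otimes> d = d \<otimes> g"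
    using idempotent_central[OF e] idempotent_central[OF d] c by auto
  have absorb: "e \<otimes> (e \<otimes> x) = e \<otimes> x" "d \<otimes> (d \<otimes> x) = d \<otimes> x" "e \<otimes> (d \<otimes> x) = \<zero>" "d \<otimes> (e \<otimes> x) = \<zero>"
    "f \<otimes> (e \<otimes> x) = e \<otimes> (f \<otimes> x)" "f \<otimes> (d \<otimes> x) = d \<otimes> (f \<otimes> x)"
    "g \<otimes> (e \<otimes> x) = e \<otimes> (g \<otimes> x)" "g \<otimes> (d \<otimes> x) = d \<otimes> (g \<otimes> x)"
    if "x \<in> carrier R" for x
    using that c by (simp_all add: sq orth comm flip: m_assoc)
  \<comment> \<open>\<open>e\<close> with its \<open>f\<close>-component flipped: this is \<open>e\<close> on \<open>gR\<close> and \<open>1 - e\<close> on \<open>fR\<close>\<close>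
  define e' where "e' = e \<otimes> g \<oplus> d \<otimes> f"
  have e'c: "e' \<in> carrier R" using c by (simp add: e'_def)
  have e': "e' \<in> idempotents R"
    using e'c c by (simp add: idempotents_def e'_def ring_simprules sq orth comm absorb)
  have ge': "g \<otimes> e' = g \<otimes> e" "(e \<otimes> f) \<otimes> e' = \<zero>" "(d \<otimes> f) \<otimes> e' = d \<otimes> f" "f \<otimes> e' = d \<otimes> f"
    using c by (simp_all add: e'_def ring_simprules sq orth comm absorb)
  define u' where "u' = b \<ominus> e'"
  have u'c: "u' \<in> carrier R" using b e'c by (simp add: u'_def)
  have "(inv u \<otimes> g) \<otimes> u' = g"
  proof (rule corner_left_inverse[OF g u'c uc Units_inv_closed[OF u]])
    have "g \<otimes> u' = g \<otimes> b \<ominus> g \<otimes> e" using c b e'c ge'(1) by (simp add: u'_def ring_simprules)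
    also have "\<dots> = g \<otimes> (b \<ominus> e)" using c b by (simp add: ring_simprules)
    also have "b \<ominus> e = u" unfolding beu using c(1) uc by algebra
    finally show "g \<otimes> u' = g \<otimes> u" .
  qed (use u c in simp)
  moreover have "(s \<otimes> (e \<otimes> f)) \<otimes> u' = e \<otimes> f"
  proof (rule corner_left_inverse[OF idempotent_mult[OF e f] u'c b s(1)])
    have "(e \<otimes> f) \<otimes> u' = (e \<otimes> f) \<otimes> b \<ominus> (e \<otimes> f) \<otimes> e'"
      unfolding u'_def using c b e'c by (simp only: minus_eq r_distr r_minus m_closed a_inv_closed)
    then show "(e \<otimes> f) \<otimes> u' = (e \<otimes> f) \<otimes> b" unfolding ge' using c b by (simp add: minus_eq)
  qed (use c s b in \<open>simp add: m_assoc\<close>)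
  moreover have "(t \<otimes> (d \<otimes> f)) \<otimes> u' = d \<otimes> f"
  proof (rule corner_left_inverse[OF idempotent_mult[OF d f] u'c minus_closed[OF b one_closed] t(1)])
    have "(d \<otimes> f) \<otimes> u' = (d \<otimes> f) \<otimes> b \<ominus> (d \<otimes> f) \<otimes> e'"
      unfolding u'_def using c b e'c by (simp only: minus_eq r_distr r_minus m_closed a_inv_closed)
    also have "\<dots> = (d \<otimes> f) \<otimes> (b \<ominus> \<one>)" unfolding ge' using c b
      by (simp add: minus_eq r_distr r_minus)
    finally show "(d \<otimes> f) \<otimes> u' = (d \<otimes> f) \<otimes> (b \<ominus> \<one>)" .
  qed (use c t b in \<open>simp add: m_assoc\<close>)
  \<comment> \<open>The three local left inverses are added; their products with \<open>u'\<close>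
    sum to \<open>g + ef + df = 1\<close>.\<close>
  moreover have "((inv u \<otimes> g) \<oplus> (s \<otimes> (e \<otimes> f)) \<oplus> (t \<otimes> (d \<otimes> f))) \<otimes> u'
    = (inv u \<otimes> g) \<otimes> u' \<oplus> (s \<otimes> (e \<otimes> f)) \<otimes> u' \<oplus> (t \<otimes> (d \<otimes> f)) \<otimes> u'"
    using c s(1) t(1) u u'c by (simp add: l_distr)
  ultimately have "((inv u \<otimes> g) \<oplus> (s \<otimes> (e \<otimes> f)) \<oplus> (t \<otimes> (d \<otimes> f))) \<otimes> u' = g \<oplus> e \<otimes> f \<oplus> d \<otimes> f"
    by simp
  also have "\<dots> = g \<oplus> (e \<oplus> d) \<otimes> f" using c by (simp add: l_distr a_assoc)
  also have "\<dots> = \<one>" using e_d f_g c by simp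
  finally have "u' \<in> Units R"
    using c s(1) t(1) u by (intro left_inverse_imp_Unit[OF u'c]) auto
  moreover have "b = e' \<oplus> u'" unfolding u'_def using b e'c by algebra
  ultimately have "e' = e" using uniq e' by blast
  \<comment> \<open>On \<open>fR\<close> the idempotent \<open>e\<close> now equals its complement;
    multiplying by \<open>e\<close> kills \<open>ef\<close>, and then \<open>df\<close> too.\<close>
  then have fe: "f \<otimes> e = d \<otimes> f" using ge'(4) by simp
  have "e \<otimes> (f \<otimes> e) = \<zero>" using c by (simp add: fe absorb)
  then have ef: "e \<otimes> f = \<zero>" using c by (simp add: comm absorb)
  moreover have "d \<otimes> f = \<zero>" using fe ef by (simp add: comm)
  moreover have "f = e \<otimes> f \<oplus> d \<otimes> f" using c e_d by (simp flip: l_distr)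
  ultimately show ?thesis by simp
qed

text \<open>As \<open>e\<close> is central, \<open>eR\<close> and \<open>(1 - e)R\<close> are
  two-sided ideals whose product is zero.\<close>

lemma idempotent_or_compl_mem_prime:
  assumes P: "two_sided_primeideal P R" and e: "e \<in> idempotents R"
  shows "e \<in> P \<or> \<one> \<ominus> e \<in> P"
proof -
  have ideal: "ideal ((\<otimes>) c ` carrier R) R" if c: "c \<in> idempotents R" for c
  proof (rule ideal_of_left_ideal[OF left_idealI])
    note cc = idempotent_carrier[OF c]
    show "(\<otimes>) c ` carrier R \<subseteq> carrier R" using cc by auto
    show "\<zero> \<in> (\<otimes>) c ` carrier R" using cc by (intro image_eqI[of _ _ \<zero>]) auto
    show "x \<oplus> y \<in> (\<otimes>) c ` carrier R" if "x \<in> (\<otimes>) c ` carrier R" "y \<in> (\<otimes>) c ` carrier R" for x y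
      using that cc by (auto simp flip: r_distr)
    show "r \<otimes> x \<in> (\<otimes>) c ` carrier R" if x: "x \<in> (\<otimes>) c ` carrier R" and r: "r \<in> carrier R" for x r
    proof -
      obtain y where y: "y \<in> carrier R" "x = c \<otimes> y" using x by blast
      have "r \<otimes> x = (r \<otimes> c) \<otimes> y" using y r cc by (simp add: m_assoc)
      also have "\<dots> = c \<otimes> (r \<otimes> y)"
        unfolding idempotent_central[OF c r] using y r cc by (simp add: m_assoc)
      finally show ?thesis using y r by auto
    qed
    show "x \<otimes> r \<in> (\<otimes>) c ` carrier R" if "x \<in> (\<otimes>) c ` carrier R" "r \<in> carrier R" for x r
      using that cc by (auto simp: m_assoc)
  qed
  note e' = idempotent_compl[OF e] and ec = idempotent_carrier[OF e]
  let ?A = "(\<otimes>) e ` carrier R" and ?B = "(\<otimes>) (\<one> \<ominus> e) ` carrier R"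
  have P_ideal: "ideal P R" using P by (rule two_sided_primeideal.axioms)
  have "x \<in> P" if "x \<in> ideal_prod R ?A ?B" for x
    using that
  proof (induction rule: ideal_prod.induct)
    case (prod i j)
    then obtain y z where *: "y \<in> carrier R" "z \<in> carrier R" "i = e \<otimes> y" "j = (\<one> \<ominus> e) \<otimes> z"
      by blast
    have "i \<otimes> j = (y \<otimes> e) \<otimes> (\<one> \<ominus> e) \<otimes> z"
      using * ec by (simp add: m_assoc idempotent_central[OF e *(1)])
    also have "\<dots> = \<zero>" using * ec idempotent_square[OF e] by (simp add: ring_simprules)
    finally show ?case using ideal_closed(2)[OF P_ideal] by simp
  next
    case (sum s1 s2)
    then show ?case using ideal_closed(3)[OF P_ideal] by blast
  qed
  then have "?A \<subseteq> P \<or> ?B \<subseteq> P"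
    by (intro two_sided_primeideal.P_prime[OF P ideal[OF e] ideal[OF e']] subsetI)
  moreover have "e \<in> ?A" using ec by (intro image_eqI[of _ _ \<one>]) auto
  moreover have "\<one> \<ominus> e \<in> ?B" using ec by (intro image_eqI[of _ _ \<one>]) auto
  ultimately show ?thesis by blast
qed

end

section \<open>The exchange property and the quotient by the radical\<close>

locale uniquely_pi_clean_ring = ring +
  assumes upc: "uniquely_pi_clean R"

sublocale uniquely_pi_clean_ring \<subseteq> central_idempotents_ring
  by unfold_locales (rule uniquely_pi_clean_imp_abelian[OF upc])

context uniquely_pi_clean_ring
begin

text \<open>Write \<open>a^n = e + u\<close> and \<open>f = 1 - e\<close>. Then
  \<open>f a^n = f u\<close> shows that \<open>f\<close> is a left multiple of \<open>a\<close>, and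
  \<open>e (1 - a^n) = -e u\<close> that \<open>e\<close> is one of \<open>1 - a^n\<close>, hence of
  its right factor \<open>1 - a\<close>.\<close>

lemma exchange:
  assumes a: "a \<in> carrier R"
  shows "\<exists>f\<in>idempotents R. \<exists>s\<in>carrier R. \<exists>t\<in>carrier R. f = s \<otimes> a \<and> \<one> \<ominus> f = t \<otimes> (\<one> \<ominus> a)"
proof -
  obtain n :: nat where n: "n > 0" "uniquely_clean R (a [^] n)"
    using upc a unfolding uniquely_pi_clean_def by blast
  obtain e u where e: "e \<in> idempotents R" and u: "u \<in> Units R" and eu: "a [^] n = e \<oplus> u"
    using uniquely_cleanD[OF n(2)] by blast
  define f where "f = \<one> \<ominus> e"
  note f = idempotent_compl[OF e, folded f_def]
  note ec = idempotent_carrier[OF e] and fc = idempotent_carrier[OF f] and uc = Units_closed[OF u]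
  note iu = Units_inv_closed[OF u]
  define X :: "int poly" where "X = [:0, 1:]"
  have X: "int_poly_eval a X = a" using a by (simp add: X_def)
  obtain k where k: "n = Suc k" using n(1) gr0_implies_Suc by blast
  define q where "q = int_poly_eval a (\<Sum>i<n. X ^ i)"
  have qc: "q \<in> carrier R" using a by (simp add: q_def)
  have "int_poly_eval a ((1 - X) * (\<Sum>i<n. X ^ i)) = int_poly_eval a (1 - X ^ n)"
    by (simp only: one_diff_power_eq)
  then have q: "q \<otimes> (\<one> \<ominus> a) = \<one> \<ominus> a [^] n"
    unfolding mult.commute[of "1 - X"] using a by (simp add: int_poly_eval_simps X q_def)
  have "f \<otimes> a [^] n = f \<otimes> u"
    unfolding eu f_def using ec uc idempotent_square[OF e] by (simp add: ring_simprules)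
  then have "(inv u \<otimes> f) \<otimes> a [^] n = f"
    using corner_left_inverse[OF f _ uc iu] a fc u by simp
  then have 1: "f = (inv u \<otimes> f \<otimes> a [^] k) \<otimes> a" using a fc iu by (simp add: k m_assoc)
  have "e \<otimes> (\<one> \<ominus> a [^] n) = e \<otimes> (\<ominus> u)"
    unfolding eu using ec uc idempotent_square[OF e] by (simp add: ring_simprules)
  then have "((\<ominus> (inv u)) \<otimes> e) \<otimes> (\<one> \<ominus> a [^] n) = e"
    using corner_left_inverse[OF e, of "\<one> \<ominus> a [^] n" "\<ominus> u" "\<ominus> (inv u)"] a ec u uc iu
    by (simp add: l_minus r_minus)
  then have "e = ((\<ominus> (inv u)) \<otimes> e \<otimes> q) \<otimes> (\<one> \<ominus> a)"
    using a ec iu qc by (simp add: m_assoc flip: q)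
  moreover have "\<one> \<ominus> f = e" unfolding f_def using ec by algebra
  ultimately show ?thesis
    using 1 f a fc ec iu qc
    by (intro bexI[of _ f] bexI[of _ "inv u \<otimes> f \<otimes> a [^] k"] bexI[of _ "(\<ominus> (inv u)) \<otimes> e \<otimes> q"]) auto
qed

text \<open>Some maximal left ideal \<open>L\<close> misses \<open>a\<close>, so
  \<open>ra + l = 1\<close> with \<open>l\<close> in \<open>L\<close>. Exchange for
  \<open>ra\<close> gives \<open>f\<close> in \<open>Ra\<close> with \<open>1 - f\<close> in
  \<open>Rl\<close>, hence in \<open>L\<close>; thus \<open>f\<close> is not zero.\<close>

lemma nonzero_idempotent_multiple:
  assumes a: "a \<in> carrier R" "a \<notin> jacobson_radical R"
  shows "\<exists>f\<in>idempotents R. f \<noteq> \<zero> \<and> (\<exists>t\<in>carrier R. f = t \<otimes> a)"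
proof -
  obtain L where L: "maximal_left_ideal L R" "a \<notin> L" using a by (auto simp: jacobson_radical_def)
  note Lc = left_ideal_closed[OF maximal_left_ideal.axioms(1)[OF L(1)]]
  obtain r l where r: "r \<in> carrier R" and l: "l \<in> L" and rl: "r \<otimes> a \<oplus> l = \<one>"
    using maximal_left_ideal_comaximal[OF L(1) a(1) L(2)] by blast
  obtain f s t where f: "f \<in> idempotents R" "s \<in> carrier R" "t \<in> carrier R"
    "f = s \<otimes> (r \<otimes> a)" "\<one> \<ominus> f = t \<otimes> (\<one> \<ominus> r \<otimes> a)"
    using exchange[OF m_closed[OF r a(1)]] by blast
  have lc: "l \<in> carrier R" using l Lc(1) by blast
  have "\<one> \<ominus> r \<otimes> a = l" unfolding rl[symmetric] using r a(1) lc by algebra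
  then have mem: "\<one> \<ominus> f \<in> L" using f(5) Lc(4)[OF l f(3)] by simp
  have "f \<noteq> \<zero>"
  proof
    assume "f = \<zero>"
    then have "\<one> \<in> L" using mem by (simp add: minus_eq)
    then show False using maximal_left_ideal_one[OF L(1)] by simp
  qed
  moreover have "f = (s \<otimes> r) \<otimes> a" using f(2,4) r a(1) by (simp add: m_assoc)
  ultimately show ?thesis using f(1,2) r by blast
qed

text \<open>This is reducedness modulo the radical. A nonzero idempotent \<open>f = ta\<close>
  satisfies \<open>f = f t a = t f a\<close> by centrality; substituting for \<open>f\<close>
  repeatedly makes it a left multiple of every power of \<open>a\<close>, so it would lie in the
  radical.\<close>

lemma power_mem_jacobson_radical:
  assumes a: "a \<in> carrier R" and mem: "a [^] (k::nat) \<in> jacobson_radical R"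
  shows "a \<in> jacobson_radical R"
proof (rule ccontr)
  assume "a \<notin> jacobson_radical R"
  then obtain f t where f: "f \<in> idempotents R" "f \<noteq> \<zero>" and t: "t \<in> carrier R" "f = t \<otimes> a"
    using nonzero_idempotent_multiple[OF a] by blast
  note fc = idempotent_carrier[OF f(1)]
  have "\<exists>s\<in>carrier R. f = s \<otimes> a [^] k" for k :: nat
  proof (induction k)
    case 0
    then show ?case using fc by (intro bexI[of _ f]) auto
  next
    case (Suc k)
    then obtain s where s: "s \<in> carrier R" "f = s \<otimes> a [^] k" by blast
    have "f = f \<otimes> (t \<otimes> a)" using idempotent_square[OF f(1)] t(2) by simp
    also have "\<dots> = (t \<otimes> f) \<otimes> a"
      using fc t(1) a by (simp add: m_assoc idempotent_central[OF f(1) t(1)])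
    also have "\<dots> = (t \<otimes> (s \<otimes> a [^] k)) \<otimes> a" by (simp only: s(2)[symmetric])
    also have "\<dots> = (t \<otimes> s) \<otimes> a [^] Suc k" using s(1) t(1) a by (simp add: m_assoc)
    finally show ?case using s(1) t(1) by blast
  qed
  then obtain s where "s \<in> carrier R" "f = s \<otimes> a [^] k" by blast
  then have "f \<in> jacobson_radical R" using jr_closed(5)[OF mem] by simp
  then show False using idempotent_jacobson_radical f by blast
qed

text \<open>An idempotent \<open>f = t b (b - 1)\<close> makes both \<open>b\<close> and
  \<open>b - 1\<close> left invertible on \<open>fR\<close>, because these two factors
  commute.\<close>

lemma uniquely_clean_mem_jacobson_radical:
  assumes clean: "uniquely_clean R b" and b: "b \<in> carrier R"
  shows "b \<otimes> (b \<ominus> \<one>) \<in> jacobson_radical R"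
proof (rule ccontr)
  have eq: "b \<otimes> (b \<ominus> \<one>) = (b \<ominus> \<one>) \<otimes> b" using b by (simp add: ring_simprules)
  assume "b \<otimes> (b \<ominus> \<one>) \<notin> jacobson_radical R"
  then obtain f t where f: "f \<in> idempotents R" "f \<noteq> \<zero>"
    and t: "t \<in> carrier R" "f = t \<otimes> (b \<otimes> (b \<ominus> \<one>))"
    using nonzero_idempotent_multiple[of "b \<otimes> (b \<ominus> \<one>)"] b by blast
  have "f \<otimes> ((t \<otimes> (b \<ominus> \<one>)) \<otimes> b) = f"
    using idempotent_square[OF f(1)] t b by (simp add: m_assoc eq)
  moreover have "f \<otimes> ((t \<otimes> b) \<otimes> (b \<ominus> \<one>)) = f"
    using idempotent_square[OF f(1)] t b by (simp add: m_assoc)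
  ultimately have "f = \<zero>"
    using t(1) b by (intro uniquely_clean_idempotent_zero[OF clean b f(1)]) auto
  then show False using f(2) by simp
qed

lemma idempotents_lift: "idempotents_lift_mod_radical R"
  unfolding idempotents_lift_mod_radical_def
proof (intro ballI impI)
  fix a assume a: "a \<in> carrier R" and mem: "a \<ominus> a [^] (2::nat) \<in> jacobson_radical R"
  obtain n :: nat where n: "n > 0" "uniquely_clean R (a [^] n)"
    using upc a unfolding uniquely_pi_clean_def by blast
  define b where "b = a [^] n"
  have bc: "b \<in> carrier R" using a by (simp add: b_def)
  \<comment> \<open>Modulo the radical \<open>a\<close> is idempotent, so it is congruent to all its
    positive powers, in particular to the uniquely clean \<open>b\<close>.\<close>
  have "a \<ominus> a [^] Suc k \<in> jacobson_radical R" for k :: nat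
  proof (induction k)
    case 0
    then show ?case using a jr_closed(2) by (simp add: minus_eq r_neg)
  next
    case (Suc k)
    have "a \<ominus> a [^] Suc (Suc k) = (a \<ominus> a [^] (2::nat)) \<oplus> (a \<ominus> a [^] Suc k) \<otimes> a"
    proof -
      have "x \<ominus> y \<otimes> x = (x \<ominus> x \<otimes> x) \<oplus> (x \<ominus> y) \<otimes> x" if "x \<in> carrier R" "y \<in> carrier R" for x y
        using that by algebra
      from this[of a "a [^] Suc k"] show ?thesis using a by (simp add: numeral_2_eq_2)
    qed
    then show ?case using jr_closed(3)[OF mem jr_closed(6)[OF Suc a]] by simp
  qed
  from this[of "n - 1"] have ab: "a \<ominus> b \<in> jacobson_radical R" using n(1) by (simp add: b_def)
  obtain e u where e: "e \<in> idempotents R" and u: "u \<in> Units R" and beu: "b = e \<oplus> u"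
    using uniquely_cleanD[OF n(2)] unfolding b_def by blast
  note ec = idempotent_carrier[OF e] and ee = idempotent_square[OF e]
  note uc = Units_closed[OF u]
  have ue: "u \<otimes> e = e \<otimes> u" by (rule idempotent_central[OF e uc])
  have "b \<otimes> (b \<ominus> \<one>) \<in> jacobson_radical R"
    using uniquely_clean_mem_jacobson_radical n(2) bc by (simp add: b_def)
  \<comment> \<open>Cancelling the unit \<open>u\<close> exhibits \<open>1 - e\<close>, rather than
    \<open>e\<close>, as the lift.\<close>
  moreover have "b \<otimes> (b \<ominus> \<one>) = u \<otimes> (b \<ominus> (\<one> \<ominus> e))"
    unfolding beu using ec uc by (simp add: ring_simprules ee ue)
  ultimately have "inv u \<otimes> (u \<otimes> (b \<ominus> (\<one> \<ominus> e))) \<in> jacobson_radical R"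
    using jr_closed(5) u by simp
  moreover have "inv u \<otimes> (u \<otimes> (b \<ominus> (\<one> \<ominus> e))) = b \<ominus> (\<one> \<ominus> e)"
    using m_assoc[OF Units_inv_closed[OF u] uc, of "b \<ominus> (\<one> \<ominus> e)"] u bc ec by simp
  ultimately have "b \<ominus> (\<one> \<ominus> e) \<in> jacobson_radical R" by simp
  from jr_closed(3)[OF ab this]
  have "a \<ominus> (\<one> \<ominus> e) \<in> jacobson_radical R"
  proof -
    have "(a \<ominus> b) \<oplus> (b \<ominus> (\<one> \<ominus> e)) = a \<ominus> (\<one> \<ominus> e)" using a bc ec by algebra
    then show ?thesis using \<open>(a \<ominus> b) \<oplus> (b \<ominus> (\<one> \<ominus> e)) \<in> jacobson_radical R\<close> by simp
  qed
  then show "\<exists>e\<in>idempotents R. a \<ominus> e \<in> jacobson_radical R"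
    using idempotent_compl[OF e] by blast
qed

text \<open>A power \<open>b = a^n\<close> is congruent modulo the radical to an idempotent
  \<open>e\<close>, and \<open>P\<close> contains \<open>1 - e\<close> or \<open>e\<close>. In the
  first case \<open>b\<close> is \<open>1\<close> modulo \<open>P\<close>; the second would put
  \<open>a\<close> into \<open>P\<close>.\<close>

lemma torsion_prime_quotient:
  assumes P: "two_sided_primeideal P R" and JP: "jacobson_radical R \<subseteq> P"
  shows "torsion_ring (R Quot P)"
proof -
  have P_ideal: "ideal P R" using P by (rule two_sided_primeideal.axioms)
  have "\<exists>n::nat. n > 0 \<and> a [^] n \<ominus> \<one> \<in> P" if a: "a \<in> carrier R" "a \<notin> P" for a
  proof -
    obtain n :: nat where n: "n > 0" "uniquely_clean R (a [^] n)"
      using upc a unfolding uniquely_pi_clean_def by blast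
    define b where "b = a [^] n"
    have b: "b \<in> carrier R" using a by (simp add: b_def)
    have "b \<otimes> (b \<ominus> \<one>) \<in> jacobson_radical R"
      using uniquely_clean_mem_jacobson_radical n(2) b by (simp add: b_def)
    then have "\<ominus> \<one> \<otimes> (b \<otimes> (b \<ominus> \<one>)) \<in> jacobson_radical R" by (simp add: jr_closed(5))
    moreover have "\<ominus> \<one> \<otimes> (b \<otimes> (b \<ominus> \<one>)) = b \<ominus> b [^] (2::nat)"
      using b by (simp add: numeral_2_eq_2 ring_simprules)
    ultimately obtain e where e: "e \<in> idempotents R" and be: "b \<ominus> e \<in> jacobson_radical R"
      using idempotents_lift b unfolding idempotents_lift_mod_radical_def by auto
    note ec = idempotent_carrier[OF e]
    show ?thesis
    proof (cases "e \<in> P")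
      case True
      define d where "d = \<one> \<ominus> e"
      note d = idempotent_compl[OF e, folded d_def]
      note dc = idempotent_carrier[OF d]
      obtain k where k: "n = Suc k" using n(1) gr0_implies_Suc by blast
      have "d \<otimes> e = \<zero>" using ec idempotent_square[OF e] by (simp add: d_def ring_simprules)
      then have "d \<otimes> (b \<ominus> e) = d \<otimes> b" using dc ec b by (simp add: minus_eq r_distr r_minus)
      then have "d \<otimes> b \<in> jacobson_radical R" using jr_closed(5)[OF be dc] by simp
      \<comment> \<open>\<open>d b\<close> is the \<open>n\<close>-th power of \<open>d a\<close>,
        so reducedness modulo the radical applies to \<open>d a\<close>.\<close>
      then have "(d \<otimes> a) [^] n \<in> jacobson_radical R"
        using idempotent_mult_power[OF d a(1), of k] by (simp only: b_def k)
      then have "d \<otimes> a \<in> P"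
        using power_mem_jacobson_radical[OF m_closed[OF dc a(1)]] JP by blast
      moreover have "e \<otimes> a \<in> P" using ideal_closed(6)[OF P_ideal True a(1)] .
      moreover have "a = e \<otimes> a \<oplus> d \<otimes> a" using ec a(1) by (simp add: d_def ring_simprules)
      ultimately have "a \<in> P" using ideal_closed(3)[OF P_ideal] by metis
      then show ?thesis using a(2) by simp
    next
      case False
      then have "\<one> \<ominus> e \<in> P" using idempotent_or_compl_mem_prime[OF P e] by blast
      then have "(b \<ominus> e) \<ominus> (\<one> \<ominus> e) \<in> P" using ideal_closed(4)[OF P_ideal] be JP by blast
      moreover have "(b \<ominus> e) \<ominus> (\<one> \<ominus> e) = b \<ominus> \<one>" using b ec by algebra
      ultimately show ?thesis using n(1) by (auto simp: b_def)
    qed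
  qed
  then show ?thesis using torsion_Quot_iff[OF P_ideal] by blast
qed

end

theorem theorem3p3:
  fixes R :: "('a, 'b) ring_scheme"
  assumes "ring R"
  shows "uniquely_pi_clean R \<longleftrightarrow>
    abelian_ring R
    \<and> idempotents_lift_mod_radical R
    \<and> (\<forall>P. two_sided_primeideal P R \<and> jacobson_radical R \<subseteq> P \<longrightarrow> torsion_ring (R Quot P))"
    (is "_ \<longleftrightarrow> _ \<and> _ \<and> ?torsion")
proof
  interpret ring R by fact
  show "abelian_ring R \<and> idempotents_lift_mod_radical R \<and> ?torsion" if "uniquely_pi_clean R"
  proof -
    interpret uniquely_pi_clean_ring R by unfold_locales fact
    show ?thesis using abelian idempotents_lift torsion_prime_quotient by blast
  qed
  show "uniquely_pi_clean R" if *: "abelian_ring R \<and> idempotents_lift_mod_radical R \<and> ?torsion"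
  proof -
    interpret central_idempotents_ring R by unfold_locales (use * in blast)
    show ?thesis using * by (intro uniquely_pi_cleanI) auto
  qed
qed

end
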